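(* Let $u\in\mathcal G_{L^2}(\Omega,\mathbb R^d)$. Then the autocovariance function $$(x,y)\mapsto C(x,y)=\mathrm E\big(u(x)u(y)\big)-\mathrm E(u(x))\,\mathrm E(u(y))$$ is a well-defined element of $\mathcal G(\mathbb R^d\times\mathbb R^d)$ (i.e., for every representative $(u_\varepsilon)_{\varepsilon\in(0,1]}$ of $u$, the functions $(x,y)\mapsto \mathrm E(u_\varepsilon(x)u_\varepsilon(y))-\mathrm E(u_\varepsilon(x))\mathrm E(u_\varepsilon(y))$ are smooth and form a family in $\mathcal E_M(\mathbb R^d\times\mathbb R^d)$, whose class in $\mathcal G(\mathbb R^d\times\mathbb R^d)$ does not depend on the choice of the representative).
   Context: $(\Omega,\Sigma,P)$ is a probability space (assumed complete whenever needed), $\mathrm E$ denotes expectation. A random field on $\mathbb R^d$ is a map $\mathbb R^d\times\Omega\to\mathbb R$, $(x,\omega)\mapsto A(x,\omega)$, such that $\omega\mapsto A(x,\omega)$ is measurable for every $x$. A family $(r_\varepsilon)_{\varepsilon\in(0,1]}$ of numbers is moderate if $\exists a\ge 0:\ |r_\varepsilon|=O(\varepsilon^{-a})$ as $\varepsilon\to0$, and negligible if $\forall b\ge0:\ |r_\varepsilon|=O(\varepsilon^{b})$ as $\varepsilon\to 0$. $\mathcal E_M(\mathbb R^m)$ (respectively $\mathcal N(\mathbb R^m)$) is the set of families $(u_\varepsilon)_{\varepsilon\in(0,1]}$ of functions in $\mathcal C^\infty(\mathbb R^m)$ such that for all compact $K\subset\mathbb R^m$ and all $\alpha\in\mathbb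 N_0^m$ the family $(\sup_{x\in K}|\partial^\alpha u_\varepsilon(x)|)_{\varepsilon}$ is moderate (respectively negligible). $\mathcal G(\mathbb R^m)=\mathcal E_M(\mathbb R^m)/\mathcal N(\mathbb R^m)$; here $\mathbb R^d\times\mathbb R^d$ is identified with $\mathbb R^{2d}$. $\mathcal E_{M,L^2}(\Omega,\mathbb R^d)$ (respectively $\mathcal N_{L^2}(\Omega,\mathbb R^d)$) is the set of families $(u_\varepsilon)_{\varepsilon\in(0,1]}$ of random fields on $\mathbb R^d$ such that: for almost all $\omega$ and all $\varepsilon\in(0,1]$, $x\mapsto u_\varepsilon(x,\omega)$ is in $\mathcal C^\infty(\mathbb R^d)$; for all $x,\varepsilon$, $\omega\mapsto u_\varepsilon(x,\omega)$ is measurable; for all $x\in\mathbb R^d$, $\alpha\in\mathbb N_0^d$, $\varepsilon\in(0,1]$, $\omega\mapsto\partial^\alpha u_\varepsilon(x,\omega)$ belongs to $L^2(\Omega)$ and for all compact $K\subset\mathbb R^d$, $\sup_{x\in K}\|\partial^\alpha u_\varepsilon(x)\|_{L^2(\Omega)}$ is finite; and for all compact $K$ and all $\alpha$, the family $(\sup_{x\in K}\|\partial^\alpha u_\varepsilon(x)\|_{L^2(\Omega)})_{\varepsilon}$ is moderate (respectively negligible). $\mathcal G_{L^2}(\Omega,\mathbb R^d)=\mathcal E_{M,L^2}(\Omega,\mathbb R^d)/\mathcal N_{L^2}(\Omega,\mathbb R^d)$. *)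

theory Defs
  imports "HOL-Probability.Probability" "HOL-Library.Landau_Symbols"
begin

section \<open>Partial derivatives and smooth functions\<close>

definition partial :: "'a::euclidean_space \<Rightarrow> ('a \<Rightarrow> real) \<Rightarrow> 'a \<Rightarrow> real" where
  "partial b f x = deriv (\<lambda>t. f (x + t *\<^sub>R b)) 0"

definition basis_list :: "'a::euclidean_space list" where
  "basis_list = (SOME bs. distinct bs \<and> set bs = Basis)"

lemma basis_list: "distinct (basis_list :: 'a::euclidean_space list)"
  "set (basis_list :: 'a list) = Basis"
proof -
  have "\<exists>bs :: 'a list. distinct bs \<and> set bs = Basis"
    using finite_distinct_list[OF finite_Basis] by blast
  from someI_ex[OF this]
  show "distinct (basis_list :: 'a list)" "set (basis_list :: 'a list) = Basis"
    by (simp_all add: basis_list_def)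
qed

text \<open>A multi-index assigns an order of differentiation to each vector of \<^term>\<open>Basis\<close>; its
  values elsewhere are ignored. The differentiations are carried out in the order of
  \<^term>\<open>basis_list\<close>, which does not matter for smooth functions.\<close>

definition mpartial :: "('a::euclidean_space \<Rightarrow> nat) \<Rightarrow> ('a \<Rightarrow> real) \<Rightarrow> 'a \<Rightarrow> real" where
  "mpartial \<alpha> f = fold (\<lambda>b. partial b ^^ \<alpha> b) basis_list f"

primrec C_diff :: "nat \<Rightarrow> ('a::euclidean_space \<Rightarrow> real) \<Rightarrow> bool" where
  "C_diff 0 f \<longleftrightarrow> continuous_on UNIV f"
| "C_diff (Suc k) f \<longleftrightarrow> continuous_on UNIV f \<and>
     (\<forall>b\<in>Basis. (\<forall>x. (\<lambda>t. f (x + t *\<^sub>R b)) field_differentiable at 0) \<and> C_diff k (partial b f))"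

definition smooth :: "('a::euclidean_space \<Rightarrow> real) \<Rightarrow> bool" where
  "smooth f \<longleftrightarrow> (\<forall>k. C_diff k f)"


section \<open>Moderate and negligible families of numbers\<close>

text \<open>Families indexed by \<open>(0,1]\<close> are functions on \<^typ>\<open>real\<close>, of which only the values on
  \<^term>\<open>{0<..1::real}\<close> are ever constrained.\<close>

definition moderate :: "(real \<Rightarrow> real) \<Rightarrow> bool" where
  "moderate r \<longleftrightarrow> (\<exists>a\<ge>0. r \<in> O[at_right 0](\<lambda>\<epsilon>. \<epsilon> powr (- a)))"

definition negligible_family :: "(real \<Rightarrow> real) \<Rightarrow> bool" where
  "negligible_family r \<longleftrightarrow> (\<forall>b\<ge>0. r \<in> O[at_right 0](\<lambda>\<epsilon>. \<epsilon> powr b))"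


section \<open>The Colombeau algebra\<close>

text \<open>Compact sets are taken nonempty below, because \<^term>\<open>Sup {} :: real\<close> is
  unspecified; with the convention \<open>sup \<emptyset> = 0\<close> the empty set imposes no condition.\<close>

definition EM :: "(real \<Rightarrow> 'a::euclidean_space \<Rightarrow> real) set" where
  "EM = {u. (\<forall>\<epsilon>\<in>{0<..1}. smooth (u \<epsilon>)) \<and>
     (\<forall>K \<alpha>. compact K \<longrightarrow> K \<noteq> {} \<longrightarrow> moderate (\<lambda>\<epsilon>. SUP x\<in>K. \<bar>mpartial \<alpha> (u \<epsilon>) x\<bar>))}"

definition Null :: "(real \<Rightarrow> 'a::euclidean_space \<Rightarrow> real) set" where
  "Null = {u. (\<forall>\<epsilon>\<in>{0<..1}. smooth (u \<epsilon>)) \<and>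
     (\<forall>K \<alpha>. compact K \<longrightarrow> K \<noteq> {} \<longrightarrow> negligible_family (\<lambda>\<epsilon>. SUP x\<in>K. \<bar>mpartial \<alpha> (u \<epsilon>) x\<bar>))}"

definition colombeau_rel ::
  "((real \<Rightarrow> 'a::euclidean_space \<Rightarrow> real) \<times> (real \<Rightarrow> 'a \<Rightarrow> real)) set" where
  "colombeau_rel = {(u, v). u \<in> EM \<and> v \<in> EM \<and> (\<lambda>\<epsilon> x. u \<epsilon> x - v \<epsilon> x) \<in> Null}"

definition colombeau :: "(real \<Rightarrow> 'a::euclidean_space \<Rightarrow> real) set set" where
  "colombeau = EM // colombeau_rel"


section \<open>The algebra of square-integrable generalized random fields\<close>

definition L2_fun :: "'w measure \<Rightarrow> ('w \<Rightarrow> real) set" where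
  "L2_fun M = {f \<in> borel_measurable M. integrable M (\<lambda>\<omega>. (f \<omega>)\<^sup>2)}"

definition L2_norm :: "'w measure \<Rightarrow> ('w \<Rightarrow> real) \<Rightarrow> real" where
  "L2_norm M f = sqrt (\<integral>\<omega>. (f \<omega>)\<^sup>2 \<partial>M)"

definition field_L2_norm ::
  "'w measure \<Rightarrow> ('a::euclidean_space \<Rightarrow> nat) \<Rightarrow> ('a \<Rightarrow> 'w \<Rightarrow> real) \<Rightarrow> 'a \<Rightarrow> real" where
  "field_L2_norm M \<alpha> A x = L2_norm M (\<lambda>\<omega>. mpartial \<alpha> (\<lambda>y. A y \<omega>) x)"

text \<open>The conditions common to the moderate and the negligible families of random fields. The
  value of \<^term>\<open>mpartial\<close> at the exceptional \<open>\<omega>\<close> with a non-smooth path is irrelevant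
  if \<open>M\<close> is complete.\<close>

definition L2_field_families :: "'w measure \<Rightarrow> (real \<Rightarrow> 'a::euclidean_space \<Rightarrow> 'w \<Rightarrow> real) set" where
  "L2_field_families M = {u.
     (AE \<omega> in M. \<forall>\<epsilon>\<in>{0<..1}. smooth (\<lambda>x. u \<epsilon> x \<omega>)) \<and>
     (\<forall>\<epsilon>\<in>{0<..1}. \<forall>x. u \<epsilon> x \<in> borel_measurable M) \<and>
     (\<forall>\<epsilon>\<in>{0<..1}. \<forall>x \<alpha>. (\<lambda>\<omega>. mpartial \<alpha> (\<lambda>y. u \<epsilon> y \<omega>) x) \<in> L2_fun M) \<and>
     (\<forall>\<epsilon>\<in>{0<..1}. \<forall>K \<alpha>. compact K \<longrightarrow> bdd_above (field_L2_norm M \<alpha> (u \<epsilon>) ` K))}"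

definition EM_L2 :: "'w measure \<Rightarrow> (real \<Rightarrow> 'a::euclidean_space \<Rightarrow> 'w \<Rightarrow> real) set" where
  "EM_L2 M = {u \<in> L2_field_families M.
     \<forall>K \<alpha>. compact K \<longrightarrow> K \<noteq> {} \<longrightarrow> moderate (\<lambda>\<epsilon>. SUP x\<in>K. field_L2_norm M \<alpha> (u \<epsilon>) x)}"

definition Null_L2 :: "'w measure \<Rightarrow> (real \<Rightarrow> 'a::euclidean_space \<Rightarrow> 'w \<Rightarrow> real) set" where
  "Null_L2 M = {u \<in> L2_field_families M.
     \<forall>K \<alpha>. compact K \<longrightarrow> K \<noteq> {} \<longrightarrow> negligible_family (\<lambda>\<epsilon>. SUP x\<in>K. field_L2_norm M \<alpha> (u \<epsilon>) x)}"

definition colombeau_L2_rel :: "'w measure \<Rightarrow>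
  ((real \<Rightarrow> 'a::euclidean_space \<Rightarrow> 'w \<Rightarrow> real) \<times> (real \<Rightarrow> 'a \<Rightarrow> 'w \<Rightarrow> real)) set" where
  "colombeau_L2_rel M =
     {(u, v). u \<in> EM_L2 M \<and> v \<in> EM_L2 M \<and> (\<lambda>\<epsilon> x \<omega>. u \<epsilon> x \<omega> - v \<epsilon> x \<omega>) \<in> Null_L2 M}"

definition colombeau_L2 :: "'w measure \<Rightarrow> (real \<Rightarrow> 'a::euclidean_space \<Rightarrow> 'w \<Rightarrow> real) set set" where
  "colombeau_L2 M = EM_L2 M // colombeau_L2_rel M"

definition autocov :: "'w measure \<Rightarrow> (real \<Rightarrow> 'a \<Rightarrow> 'w \<Rightarrow> real) \<Rightarrow> real \<Rightarrow> 'a \<times> 'a \<Rightarrow> real" where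
  "autocov M u \<epsilon> = (\<lambda>(x, y).
     (\<integral>\<omega>. u \<epsilon> x \<omega> * u \<epsilon> y \<omega> \<partial>M) - (\<integral>\<omega>. u \<epsilon> x \<omega> \<partial>M) * (\<integral>\<omega>. u \<epsilon> y \<omega> \<partial>M))"

end

theory Submission
  imports Defs
begin

text \<open>Locally uniform bounds on the \<open>L\<^sup>2\<close> norms of all derivatives make \<open>x \<mapsto> A x\<close> smooth as a map into
  \<open>L\<^sup>2\<close>: increments are limits of Riemann sums of a derivative, so Fatou's lemma bounds them by the
  norms of that derivative, and applying this to the next derivative gives a first-order Taylor
  estimate. The covariance is a bounded bilinear form on \<open>L\<^sup>2\<close>, hence every derivative of the
  autocovariance is the covariance of two derivatives of the field, and Cauchy-Schwarz turns
  moderateness and negligibility of the field into those of the autocovariance.\<close>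

section \<open>Calculus of partial derivatives\<close>

text \<open>The obstacle is that suprema over \<open>x\<close> stand outside the
  \<open>L\<^sup>2\<close> norm. Nothing bounds the expectation of a supremum of the path
  derivatives, so no integrable majorant is available for differentiating under the expectation.
  Fatou's lemma needs only one-sided control of norms at fixed points, and Riemann sums use only
  finitely many points, so joint measurability in parameter and \<omega> never enters. Each estimate
  costs further derivatives, which is harmless because all orders are bounded on compact sets. Two
  features of the encoding shape the rest. \<open>mpartial\<close> differentiates in a fixed order,
  so appending one more derivative requires the symmetry of mixed derivatives. \<open>smooth\<close>
  asks for joint continuity besides derivatives along coordinate lines, so continuity of covariances
  is proved separately, through a Lipschitz estimate assembled from coordinate steps.\<close>

lemma smooth_imp_continuous: "smooth f \<Longrightarrow> continuous_on S f"
  unfolding smooth_def by (metis C_diff.simps(1) continuous_on_subset subset_UNIV)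

lemma smooth_partial:
  assumes "smooth f" "b \<in> Basis"
  shows "smooth (partial b f)"
  unfolding smooth_def
proof
  fix k
  have "C_diff (Suc k) f"
    using assms by (simp only: smooth_def)
  then show "C_diff k (partial b f)"
    using assms by simp
qed

lemma smooth_partial_power: "smooth f \<Longrightarrow> b \<in> Basis \<Longrightarrow> smooth ((partial b ^^ n) f)"
  by (induction n) (auto intro: smooth_partial)

text \<open>\<open>C_diff\<close> speaks only of the parameter value 0. Moving the base point to
  \<open>x + s *\<^sub>R b\<close> gives the derivative along the whole line, as the mean value
  theorem requires.\<close>

lemma smooth_has_partial:
  assumes "smooth f" "b \<in> Basis"
  shows "((\<lambda>s. f (x + s *\<^sub>R b)) has_real_derivative partial b f (x + s *\<^sub>R b)) (at s)"
proof -
  have "C_diff (Suc 0) f"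
    using assms by (simp only: smooth_def)
  then have "(\<lambda>t. f ((x + s *\<^sub>R b) + t *\<^sub>R b)) field_differentiable at 0"
    using assms(2) by simp
  then have "((\<lambda>t. f ((x + s *\<^sub>R b) + t *\<^sub>R b)) has_real_derivative partial b f (x + s *\<^sub>R b)) (at 0)"
    unfolding partial_def by (simp add: field_differentiable_derivI)
  then have "((\<lambda>t. f (x + (t + s) *\<^sub>R b)) has_real_derivative partial b f (x + s *\<^sub>R b)) (at 0)"
    by (simp add: algebra_simps)
  then show ?thesis
    using DERIV_shift[of "\<lambda>t. f (x + t *\<^sub>R b)" _ 0 s] by simp
qed

lemma partial_eqI:
  "((\<lambda>t. f (x + t *\<^sub>R b)) has_real_derivative D) (at 0) \<Longrightarrow> partial b f x = D"
  unfolding partial_def by (rule DERIV_imp_deriv)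

lemma C_diff_diff: "C_diff k f \<Longrightarrow> C_diff k g \<Longrightarrow> C_diff k (\<lambda>x. f x - g x)"
proof (induction k arbitrary: f g)
  case 0
  then show ?case by (simp add: continuous_on_diff)
next
  case (Suc k)
  have "partial b (\<lambda>x. f x - g x) = (\<lambda>x. partial b f x - partial b g x)" if "b \<in> Basis" for b
    using Suc.prems that by (auto simp: partial_def fun_eq_iff)
  then show ?case
    using Suc by (auto intro: continuous_on_diff field_differentiable_diff)
qed

lemma smooth_diff: "smooth f \<Longrightarrow> smooth g \<Longrightarrow> smooth (\<lambda>x. f x - g x)"
  by (simp add: smooth_def C_diff_diff)

lemma partial_diff:
  assumes "smooth f" "smooth g" "b \<in> Basis"
  shows "partial b (\<lambda>x. f x - g x) = (\<lambda>x. partial b f x - partial b g x)"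
proof
  fix x
  show "partial b (\<lambda>x. f x - g x) x = partial b f x - partial b g x"
    using smooth_has_partial[of f b x 0] smooth_has_partial[of g b x 0] assms
    by (intro partial_eqI) (auto intro: DERIV_diff)
qed

lemma fold_partial_diff:
  assumes "set bs \<subseteq> Basis" "smooth f" "smooth g"
  shows "fold (\<lambda>b. partial b ^^ \<alpha> b) bs (\<lambda>x. f x - g x) =
    (\<lambda>x. fold (\<lambda>b. partial b ^^ \<alpha> b) bs f x - fold (\<lambda>b. partial b ^^ \<alpha> b) bs g x)"
  using assms
proof (induction bs arbitrary: f g)
  case (Cons b bs)
  have "(partial b ^^ n) (\<lambda>x. f x - g x) = (\<lambda>x. (partial b ^^ n) f x - (partial b ^^ n) g x)" for n
    using Cons.prems by (induction n) (auto simp: partial_diff smooth_partial_power)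
  then show ?case
    using Cons by (simp add: smooth_partial_power)
qed simp

lemma mpartial_diff:
  assumes "smooth f" "smooth g"
  shows "mpartial \<alpha> (\<lambda>x. f x - g x) x = mpartial \<alpha> f x - mpartial \<alpha> g x"
  unfolding mpartial_def using assms by (subst fold_partial_diff) (auto simp: basis_list(2))

lemma smooth_fold_partial:
  "set bs \<subseteq> Basis \<Longrightarrow> smooth f \<Longrightarrow> smooth (fold (\<lambda>b. partial b ^^ \<alpha> b) bs f)"
  by (induction bs arbitrary: f) (auto simp: smooth_partial_power)

lemma smooth_mpartial: "smooth f \<Longrightarrow> smooth (mpartial \<alpha> f)"
  unfolding mpartial_def by (rule smooth_fold_partial) (simp_all add: basis_list(2))

text \<open>Both mixed derivatives are limits of the same second difference quotient.\<close>

lemma second_difference_quotient: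
  fixes f :: "'a::euclidean_space \<Rightarrow> real"
  assumes f: "smooth f" and b: "b \<in> Basis" and c: "c \<in> Basis"
  shows "((\<lambda>h. (f (x + h *\<^sub>R b + h *\<^sub>R c) - f (x + h *\<^sub>R b) - f (x + h *\<^sub>R c) + f x) / h\<^sup>2)
    \<longlongrightarrow> partial c (partial b f) x) (at_right 0)"
proof -
  define q where "q h = (f (x + h *\<^sub>R b + h *\<^sub>R c) - f (x + h *\<^sub>R b) - f (x + h *\<^sub>R c) + f x) / h\<^sup>2" for h
  let ?g = "partial c (partial b f)"
  have "\<exists>z. norm (z - x) \<le> 2 * h \<and> q h = ?g z" if h: "h > 0" for h
  proof -
    \<comment> \<open>The double difference is \<open>\<phi> h - \<phi> 0\<close>; the mean value
      theorem along \<open>b\<close> and then along \<open>c\<close> turns it into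
      \<open>h * h\<close> times a mixed derivative at a point close to \<open>x\<close>.\<close>
    define \<phi> where "\<phi> s = f ((x + h *\<^sub>R c) + s *\<^sub>R b) - f (x + s *\<^sub>R b)" for s
    obtain s where s: "0 < s" "s < h"
      "\<phi> h - \<phi> 0 = (h - 0) * (partial b f ((x + h *\<^sub>R c) + s *\<^sub>R b) - partial b f (x + s *\<^sub>R b))"
    proof -
      have "(\<phi> has_real_derivative partial b f ((x + h *\<^sub>R c) + s *\<^sub>R b) - partial b f (x + s *\<^sub>R b)) (at s)" for s
        unfolding \<phi>_def by (intro DERIV_diff smooth_has_partial[OF f b])
      from MVT2[OF h this] show thesis
        using that by blast
    qed
    obtain t where t: "0 < t" "t < h"
      "partial b f ((x + s *\<^sub>R b) + h *\<^sub>R c) - partial b f ((x + s *\<^sub>R b) + 0 *\<^sub>R c) =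
        (h - 0) * ?g ((x + s *\<^sub>R b) + t *\<^sub>R c)"
      using MVT2[OF h, of "\<lambda>t. partial b f ((x + s *\<^sub>R b) + t *\<^sub>R c)" "\<lambda>t. ?g ((x + s *\<^sub>R b) + t *\<^sub>R c)"]
      by (auto intro!: smooth_has_partial[OF smooth_partial[OF f b] c])
    have "\<phi> h - \<phi> 0 = h * (h * ?g (x + s *\<^sub>R b + t *\<^sub>R c))"
      using s(3) t(3) by (simp add: add_ac)
    then have "q h = ?g (x + s *\<^sub>R b + t *\<^sub>R c)"
      using h unfolding q_def \<phi>_def by (simp add: field_simps power2_eq_square add_ac)
    moreover have "norm (s *\<^sub>R b + t *\<^sub>R c) \<le> 2 * h"
      using norm_triangle_ineq[of "s *\<^sub>R b" "t *\<^sub>R c"] s t b c by simp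
    ultimately show ?thesis
      by (intro exI[of _ "x + s *\<^sub>R b + t *\<^sub>R c"]) (simp add: add_diff_eq add.assoc)
  qed
  then obtain z where z: "\<And>h. h > 0 \<Longrightarrow> norm (z h - x) \<le> 2 * h" "\<And>h. h > 0 \<Longrightarrow> q h = ?g (z h)"
    by metis
  have "((\<lambda>h. z h - x) \<longlongrightarrow> 0) (at_right 0)"
  proof (rule Lim_null_comparison)
    show "\<forall>\<^sub>F h in at_right 0. norm (z h - x) \<le> 2 * h"
      using eventually_at_right_less[of 0] by eventually_elim (rule z)
    show "((\<lambda>h. 2 * h) \<longlongrightarrow> 0) (at_right (0::real))"
      by (auto intro!: tendsto_eq_intros)
  qed
  then have "(z \<longlongrightarrow> x) (at_right 0)"
    by (rule LIM_zero_cancel)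
  moreover have "isCont ?g x"
    using smooth_imp_continuous[of ?g UNIV] f b c
    by (simp add: smooth_partial continuous_on_eq_continuous_at)
  ultimately have "((\<lambda>h. ?g (z h)) \<longlongrightarrow> ?g x) (at_right 0)"
    by (rule isCont_tendsto_compose[rotated])
  moreover have "\<forall>\<^sub>F h in at_right 0. ?g (z h) = q h"
    using eventually_at_right_less[of 0] by eventually_elim (simp add: z)
  ultimately have "(q \<longlongrightarrow> ?g x) (at_right 0)"
    by (rule Lim_transform_eventually)
  then show ?thesis
    by (simp add: q_def[abs_def])
qed

lemma partial_commute:
  assumes "smooth f" "b \<in> Basis" "c \<in> Basis"
  shows "partial b (partial c f) = partial c (partial b f)"
proof
  fix x
  let ?q = "\<lambda>b c h. (f (x + h *\<^sub>R b + h *\<^sub>R c) - f (x + h *\<^sub>R b) - f (x + h *\<^sub>R c) + f x) / h\<^sup>2"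
  have "?q b c = ?q c b"
    by (simp add: fun_eq_iff add_ac)
  then show "partial b (partial c f) x = partial c (partial b f) x"
    using second_difference_quotient[of f b c x] second_difference_quotient[of f c b x] assms
    by (auto intro: tendsto_unique[of "at_right (0::real)"])
qed

section \<open>Multi-indices and the order of differentiation\<close>

lemma partial_power_commute:
  assumes "smooth f" "b \<in> Basis" "c \<in> Basis"
  shows "partial b ((partial c ^^ n) f) = (partial c ^^ n) (partial b f)"
  using assms by (induction n) (simp_all add: partial_commute[of _ b c] smooth_partial_power)

lemma partial_fold_partial:
  assumes "set bs \<subseteq> Basis" "b \<in> Basis" "smooth f"
  shows "partial b (fold (\<lambda>b. partial b ^^ \<alpha> b) bs f) = fold (\<lambda>b. partial b ^^ \<alpha> b) bs (partial b f)"
  using assms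
  by (induction bs arbitrary: f) (auto simp: partial_power_commute smooth_partial_power)

text \<open>The additional derivative is created in the middle of the fold, at the position of
  \<open>b\<close>, and commutation carries it to the outside. Distinctness ensures that
  \<open>b\<close> is met only once.\<close>

lemma fold_partial_upd:
  assumes "set bs \<subseteq> Basis" "distinct bs" "b \<in> set bs" "smooth f"
  shows "fold (\<lambda>c. partial c ^^ (\<alpha>(b := Suc (\<alpha> b))) c) bs f = partial b (fold (\<lambda>c. partial c ^^ \<alpha> c) bs f)"
  using assms
proof (induction bs arbitrary: f)
  case (Cons c cs)
  show ?case
  proof (cases "c = b")
    case True
    then have "fold (\<lambda>c. partial c ^^ (\<alpha>(b := Suc (\<alpha> b))) c) cs g = fold (\<lambda>c. partial c ^^ \<alpha> c) cs g" for g
      using Cons.prems by (intro fold_cong) auto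
    then show ?thesis
      using True Cons.prems by (simp add: partial_fold_partial smooth_partial_power)
  next
    case False
    then show ?thesis
      using Cons by (simp add: smooth_partial_power)
  qed
qed simp

text \<open>Thus the derivatives indexed by multi-indices are closed under differentiation, and
  bounds on all of them also bound the derivatives of each.\<close>

lemma partial_mpartial:
  assumes "smooth f" "b \<in> Basis"
  shows "partial b (mpartial \<alpha> f) = mpartial (\<alpha>(b := Suc (\<alpha> b))) f"
  unfolding mpartial_def using assms basis_list by (intro fold_partial_upd[symmetric]) auto

lemma mpartial_zero: "mpartial (\<lambda>_. 0) f = f"
proof -
  have "fold (\<lambda>b. partial b ^^ 0) bs f = f" for bs
    by (induction bs) auto
  then show ?thesis
    by (simp add: mpartial_def)
qed

section \<open>Square-integrable functions\<close>

lemma L2_fun_measurable: "f \<in> L2_fun M \<Longrightarrow> f \<in> borel_measurable M"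
  by (simp add: L2_fun_def)

lemma L2_fun_square_integrable: "f \<in> L2_fun M \<Longrightarrow> integrable M (\<lambda>\<omega>. (f \<omega>)\<^sup>2)"
  by (simp add: L2_fun_def)

lemma L2_fun_mult_integrable:
  assumes "f \<in> L2_fun M" "g \<in> L2_fun M"
  shows "integrable M (\<lambda>\<omega>. f \<omega> * g \<omega>)"
proof (rule Bochner_Integration.integrable_bound)
  show "integrable M (\<lambda>\<omega>. (f \<omega>)\<^sup>2 + (g \<omega>)\<^sup>2)"
    using assms by (simp add: L2_fun_def)
  show "(\<lambda>\<omega>. f \<omega> * g \<omega>) \<in> borel_measurable M"
    using assms[THEN L2_fun_measurable] by simp
  have "\<bar>a * b\<bar> \<le> a\<^sup>2 + b\<^sup>2" for a b :: real
  proof -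
    have "2 * \<bar>a * b\<bar> \<le> a\<^sup>2 + b\<^sup>2"
      using sum_squares_bound[of "\<bar>a\<bar>" "\<bar>b\<bar>"] by (simp add: abs_mult mult.assoc)
    then show ?thesis
      by linarith
  qed
  then show "AE \<omega> in M. norm (f \<omega> * g \<omega>) \<le> norm ((f \<omega>)\<^sup>2 + (g \<omega>)\<^sup>2)"
    by simp
qed

lemma L2_fun_cmult: "f \<in> L2_fun M \<Longrightarrow> (\<lambda>\<omega>. c * f \<omega>) \<in> L2_fun M"
  by (auto simp: L2_fun_def power_mult_distrib intro!: borel_measurable_times)

lemma L2_fun_add:
  assumes "f \<in> L2_fun M" "g \<in> L2_fun M"
  shows "(\<lambda>\<omega>. f \<omega> + g \<omega>) \<in> L2_fun M"
  using assms L2_fun_mult_integrable[OF assms] by (auto simp: L2_fun_def power2_sum mult.assoc)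

lemma L2_fun_diff:
  assumes "f \<in> L2_fun M" "g \<in> L2_fun M"
  shows "(\<lambda>\<omega>. f \<omega> - g \<omega>) \<in> L2_fun M"
  using L2_fun_add[OF assms(1) L2_fun_cmult[OF assms(2), of "-1"]] by simp

lemma L2_fun_zero: "(\<lambda>_. 0) \<in> L2_fun M"
  by (simp add: L2_fun_def)

lemma L2_fun_sum:
  "(\<And>i. i \<in> I \<Longrightarrow> f i \<in> L2_fun M) \<Longrightarrow> (\<lambda>\<omega>. \<Sum>i\<in>I. f i \<omega>) \<in> L2_fun M"
  by (induction I rule: infinite_finite_induct) (auto intro: L2_fun_add L2_fun_zero)

section \<open>The mean-square seminorm and the Cauchy-Schwarz inequality\<close>

lemma L2_norm_nonneg: "0 \<le> L2_norm M f"
  by (simp add: L2_norm_def)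

lemma L2_norm_power2: "(L2_norm M f)\<^sup>2 = (\<integral>\<omega>. (f \<omega>)\<^sup>2 \<partial>M)"
  by (simp add: L2_norm_def)

lemma L2_norm_zero: "L2_norm M (\<lambda>_. 0) = 0"
  by (simp add: L2_norm_def)

lemma L2_norm_cmult: "L2_norm M (\<lambda>\<omega>. c * f \<omega>) = \<bar>c\<bar> * L2_norm M f"
  by (simp add: L2_norm_def power_mult_distrib real_sqrt_mult)

lemma L2_norm_cong_AE:
  assumes "f \<in> L2_fun M" "g \<in> L2_fun M" "AE \<omega> in M. f \<omega> = g \<omega>"
  shows "L2_norm M f = L2_norm M g"
proof -
  have "(\<integral>\<omega>. (f \<omega>)\<^sup>2 \<partial>M) = (\<integral>\<omega>. (g \<omega>)\<^sup>2 \<partial>M)"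
    using assms by (intro integral_cong_AE) (auto simp: L2_fun_def)
  then show ?thesis
    by (simp add: L2_norm_def)
qed

lemma L2_Cauchy_Schwarz:
  assumes f: "f \<in> L2_fun M" and g: "g \<in> L2_fun M"
  shows "\<bar>\<integral>\<omega>. f \<omega> * g \<omega> \<partial>M\<bar> \<le> L2_norm M f * L2_norm M g"
proof -
  let ?a = "\<integral>\<omega>. (f \<omega>)\<^sup>2 \<partial>M" and ?b = "\<integral>\<omega>. (g \<omega>)\<^sup>2 \<partial>M" and ?c = "\<integral>\<omega>. f \<omega> * g \<omega> \<partial>M"
  \<comment> \<open>Discriminant argument: this quadratic in \<open>t\<close> is the mean square of
    \<open>f - t * g\<close>.\<close>
  have q: "0 \<le> ?a - 2 * t * ?c + t\<^sup>2 * ?b" for t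
  proof -
    have "0 \<le> (\<integral>\<omega>. (f \<omega> - t * g \<omega>)\<^sup>2 \<partial>M)"
      by simp
    also have "(\<lambda>\<omega>. (f \<omega> - t * g \<omega>)\<^sup>2) = (\<lambda>\<omega>. (f \<omega>)\<^sup>2 - 2 * t * (f \<omega> * g \<omega>) + t\<^sup>2 * (g \<omega>)\<^sup>2)"
      by (simp add: power2_eq_square algebra_simps)
    also have "(\<integral>\<omega>. (f \<omega>)\<^sup>2 - 2 * t * (f \<omega> * g \<omega>) + t\<^sup>2 * (g \<omega>)\<^sup>2 \<partial>M) = ?a - 2 * t * ?c + t\<^sup>2 * ?b"
      using L2_fun_mult_integrable[OF f g] L2_fun_square_integrable[OF f] L2_fun_square_integrable[OF g]
      by simp
    finally show ?thesis .
  qed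
  have "0 \<le> ?b"
    by simp
  then consider "?b = 0" | "?b > 0"
    by linarith
  then have "?c\<^sup>2 \<le> ?a * ?b"
  proof cases
    case 1
    have "?c = 0"
    proof (rule ccontr)
      assume "?c \<noteq> 0"
      \<comment> \<open>With \<open>?b = 0\<close> the quadratic is affine in \<open>t\<close>, and
        this \<open>t\<close> is chosen to give it the value -1.\<close>
      then show False
        using q[of "(?a + 1) / (2 * ?c)"] 1 by simp
    qed
    then show ?thesis
      using 1 by simp
  next
    case 2
    \<comment> \<open>The quadratic is evaluated at its minimum.\<close>
    then show ?thesis
      using q[of "?c / ?b"] by (simp add: field_simps power2_eq_square)
  qed
  then have "sqrt (?c\<^sup>2) \<le> sqrt (?a * ?b)"
    by (rule real_sqrt_le_mono)
  then show ?thesis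
    by (simp add: L2_norm_def real_sqrt_mult)
qed

lemma L2_norm_add:
  assumes f: "f \<in> L2_fun M" and g: "g \<in> L2_fun M"
  shows "L2_norm M (\<lambda>\<omega>. f \<omega> + g \<omega>) \<le> L2_norm M f + L2_norm M g"
proof (rule power2_le_imp_le)
  have "(L2_norm M (\<lambda>\<omega>. f \<omega> + g \<omega>))\<^sup>2 = (\<integral>\<omega>. (f \<omega>)\<^sup>2 + 2 * (f \<omega> * g \<omega>) + (g \<omega>)\<^sup>2 \<partial>M)"
    unfolding L2_norm_power2 by (simp add: power2_eq_square algebra_simps)
  also have "\<dots> = (L2_norm M f)\<^sup>2 + 2 * (\<integral>\<omega>. f \<omega> * g \<omega> \<partial>M) + (L2_norm M g)\<^sup>2"
    using L2_fun_mult_integrable[OF f g] L2_fun_square_integrable[OF f] L2_fun_square_integrable[OF g]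
    by (simp add: L2_norm_power2)
  also have "\<dots> \<le> (L2_norm M f + L2_norm M g)\<^sup>2"
    using L2_Cauchy_Schwarz[OF f g] by (simp add: power2_sum)
  finally show "(L2_norm M (\<lambda>\<omega>. f \<omega> + g \<omega>))\<^sup>2 \<le> (L2_norm M f + L2_norm M g)\<^sup>2" .
qed (simp add: L2_norm_nonneg)

lemma L2_norm_sum:
  "(\<And>i. i \<in> I \<Longrightarrow> f i \<in> L2_fun M) \<Longrightarrow>
    L2_norm M (\<lambda>\<omega>. \<Sum>i\<in>I. f i \<omega>) \<le> (\<Sum>i\<in>I. L2_norm M (f i))"
proof (induction I rule: infinite_finite_induct)
  case (insert i I)
  then have "L2_norm M (\<lambda>\<omega>. f i \<omega> + (\<Sum>i\<in>I. f i \<omega>)) \<le>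
      L2_norm M (f i) + L2_norm M (\<lambda>\<omega>. \<Sum>i\<in>I. f i \<omega>)"
    by (intro L2_norm_add L2_fun_sum) auto
  then show ?case
    using insert by fastforce
qed (simp_all add: L2_norm_zero)

text \<open>Lower semicontinuity of the norm under almost sure convergence: Fatou's lemma applied to
  the squares, without any domination.\<close>

lemma L2_norm_limit_le:
  assumes X: "\<And>n. X n \<in> L2_fun M" and Y: "Y \<in> L2_fun M"
    and lim: "AE \<omega> in M. (\<lambda>n. X n \<omega>) \<longlonglongrightarrow> Y \<omega>"
    and le: "\<And>n. L2_norm M (X n) \<le> C"
  shows "L2_norm M Y \<le> C"
proof -
  have C: "0 \<le> C"
    using le[of 0] L2_norm_nonneg[of M "X 0"] by linarith
  have "(\<integral>\<^sup>+\<omega>. ennreal ((Y \<omega>)\<^sup>2) \<partial>M) = (\<integral>\<^sup>+\<omega>. liminf (\<lambda>n. ennreal ((X n \<omega>)\<^sup>2)) \<partial>M)"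
  proof (rule nn_integral_cong_AE, use lim in eventually_elim)
    case (elim \<omega>)
    then have "(\<lambda>n. ennreal ((X n \<omega>)\<^sup>2)) \<longlonglongrightarrow> ennreal ((Y \<omega>)\<^sup>2)"
      by (intro tendsto_intros)
    then show ?case
      by (rule lim_imp_Liminf[OF trivial_limit_sequentially, symmetric])
  qed
  also have "\<dots> \<le> liminf (\<lambda>n. \<integral>\<^sup>+\<omega>. ennreal ((X n \<omega>)\<^sup>2) \<partial>M)"
    using L2_fun_measurable[OF X] by (intro nn_integral_liminf) simp
  also have "\<dots> \<le> ennreal (C\<^sup>2)"
  proof -
    have "(\<integral>\<^sup>+\<omega>. ennreal ((X n \<omega>)\<^sup>2) \<partial>M) \<le> ennreal (C\<^sup>2)" for n
      using L2_fun_square_integrable[OF X] power_mono[OF le L2_norm_nonneg, of n 2]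
      by (simp add: nn_integral_eq_integral L2_norm_power2 ennreal_leI)
    then have "liminf (\<lambda>n. \<integral>\<^sup>+\<omega>. ennreal ((X n \<omega>)\<^sup>2) \<partial>M) \<le> liminf (\<lambda>n. ennreal (C\<^sup>2))"
      by (intro Liminf_mono) simp
    then show ?thesis
      by (simp add: Liminf_const)
  qed
  finally have "(L2_norm M Y)\<^sup>2 \<le> C\<^sup>2"
    using L2_fun_square_integrable[OF Y] C by (simp add: nn_integral_eq_integral L2_norm_power2)
  then show ?thesis
    using C by (rule power2_le_imp_le)
qed

text \<open>On each subinterval the mean value theorem writes the increment of \<open>g\<close> with
  \<open>g'\<close> at an inner point, and uniform continuity moves that point to the left end. Only
  finite sums occur, so the statement can be used path by path while the sums remain random
  variables.\<close>

lemma Riemann_sum_tendsto: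
  fixes g g' :: "real \<Rightarrow> real"
  assumes der: "\<And>s. (g has_real_derivative g' s) (at s)" and cont: "continuous_on {0..1} g'"
  shows "(\<lambda>n. \<Sum>i<n. 1 / real n * g' (real i / real n)) \<longlonglongrightarrow> g 1 - g 0"
proof (rule LIMSEQ_I)
  fix e :: real
  assume "0 < e"
  \<comment> \<open>Half of \<open>e\<close> is requested because summing the errors gives only a
    weak inequality.\<close>
  then obtain d where d: "d > 0"
    "\<And>s t. s \<in> {0..1} \<Longrightarrow> t \<in> {0..1} \<Longrightarrow> dist s t < d \<Longrightarrow> dist (g' s) (g' t) < e / 2"
    using compact_uniformly_continuous[OF cont] unfolding uniformly_continuous_on_def
    by (metis compact_Icc half_gt_zero)
  obtain N where N: "N > 0" "1 / real N < d"
    using d(1) by (metis nat_approx_posE zero_less_Suc of_nat_Suc)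
  have "norm ((\<Sum>i<n. 1 / real n * g' (real i / real n)) - (g 1 - g 0)) < e" if n: "n \<ge> N" for n
  proof -
    have n0: "0 < real n" "1 / real n < d"
      using n N by (auto intro: le_less_trans[OF _ N(2)] simp: frac_le)
    have "\<bar>1 / real n * g' (real i / real n) - (g (real (Suc i) / real n) - g (real i / real n))\<bar>
        \<le> 1 / real n * (e / 2)" if i: "i < n" for i
    proof -
      have lt: "real i / real n < real (Suc i) / real n"
        using n0 by (simp add: divide_strict_right_mono)
      obtain z where z: "real i / real n < z" "z < real (Suc i) / real n"
        "g (real (Suc i) / real n) - g (real i / real n) = (real (Suc i) / real n - real i / real n) * g' z"
        using MVT2[OF lt der] by blast
      have len: "real (Suc i) / real n - real i / real n = 1 / real n"
        by (simp add: diff_divide_distrib[symmetric])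
      have "real (Suc i) / real n \<le> 1" "0 \<le> real i / real n"
        using i n0 by (auto simp: divide_le_eq)
      then have "0 \<le> z" "z \<le> 1" "real i / real n \<le> 1"
        using z lt by linarith+
      moreover have "dist (real i / real n) z < d"
        using z n0 len unfolding dist_real_def by linarith
      ultimately have "dist (g' (real i / real n)) (g' z) < e / 2"
        using \<open>0 \<le> real i / real n\<close> by (intro d(2)) (simp_all only: atLeastAtMost_iff)
      then have "\<bar>g' (real i / real n) - g' z\<bar> \<le> e / 2"
        by (simp add: dist_real_def)
      then have "1 / real n * \<bar>g' (real i / real n) - g' z\<bar> \<le> 1 / real n * (e / 2)"
        using n0 by (intro mult_left_mono) auto
      moreover have "1 / real n * g' (real i / real n) - 1 / real n * g' z
          = 1 / real n * (g' (real i / real n) - g' z)"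
        by (simp add: algebra_simps)
      ultimately show ?thesis
        using z(3) len n0 by (simp only: abs_mult) simp
    qed
    then have "(\<Sum>i<n. \<bar>1 / real n * g' (real i / real n) - (g (real (Suc i) / real n) - g (real i / real n))\<bar>)
        \<le> (\<Sum>i<n. 1 / real n * (e / 2))"
      by (intro sum_mono) auto
    also have "\<dots> = e / 2"
      using n0 by simp
    finally have "\<bar>\<Sum>i<n. 1 / real n * g' (real i / real n) - (g (real (Suc i) / real n) - g (real i / real n))\<bar> \<le> e / 2"
      by (rule order_trans[OF sum_abs])
    moreover have "(\<Sum>i<n. g (real (Suc i) / real n) - g (real i / real n)) = g 1 - g 0"
      using n0 by (subst sum_lessThan_telescope[of "\<lambda>i. g (real i / real n)"]) simp
    ultimately show ?thesis
      using \<open>0 < e\<close> by (simp add: sum_subtractf)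
  qed
  then show "\<exists>N. \<forall>n\<ge>N. norm ((\<Sum>i<n. 1 / real n * g' (real i / real n)) - (g 1 - g 0)) < e"
    by blast
qed

text \<open>The increment is the pointwise limit of Riemann sums of the derivative, so Fatou's lemma applies.\<close>

lemma L2_norm_increment_le:
  fixes g g' :: "real \<Rightarrow> 'w \<Rightarrow> real"
  assumes g: "\<And>s. g s \<in> L2_fun M" and g': "\<And>s. g' s \<in> L2_fun M"
    and der: "AE \<omega> in M. (\<forall>s. ((\<lambda>s. g s \<omega>) has_real_derivative g' s \<omega>) (at s)) \<and>
      continuous_on {0..1} (\<lambda>s. g' s \<omega>)"
    and le: "\<And>s. 0 \<le> s \<Longrightarrow> s \<le> 1 \<Longrightarrow> L2_norm M (g' s) \<le> C"
  shows "L2_norm M (\<lambda>\<omega>. g 1 \<omega> - g 0 \<omega>) \<le> C"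
proof (rule L2_norm_limit_le)
  let ?X = "\<lambda>n \<omega>. \<Sum>i<n. 1 / real n * g' (real i / real n) \<omega>"
  show "?X n \<in> L2_fun M" for n
    by (intro L2_fun_sum L2_fun_cmult g')
  show "(\<lambda>\<omega>. g 1 \<omega> - g 0 \<omega>) \<in> L2_fun M"
    by (intro L2_fun_diff g)
  show "AE \<omega> in M. (\<lambda>n. ?X n \<omega>) \<longlonglongrightarrow> g 1 \<omega> - g 0 \<omega>"
    using der by eventually_elim (rule Riemann_sum_tendsto, auto)
  have C: "0 \<le> C"
    using le[of 0] L2_norm_nonneg[of M "g' 0"] by simp
  show "L2_norm M (?X n) \<le> C" for n
  proof -
    have "L2_norm M (?X n) \<le> (\<Sum>i<n. L2_norm M (\<lambda>\<omega>. 1 / real n * g' (real i / real n) \<omega>))"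
      by (intro L2_norm_sum L2_fun_cmult g')
    also have "\<dots> \<le> (\<Sum>i<n. 1 / real n * C)"
      unfolding L2_norm_cmult by (intro sum_mono mult_mono le) (auto simp: C L2_norm_nonneg)
    \<comment> \<open>The sum is \<open>C\<close> for positive \<open>n\<close> but empty for
      \<open>n = 0\<close>, where \<open>C \<ge> 0\<close> is used.\<close>
    also have "\<dots> \<le> C"
      using C by simp
    finally show ?thesis .
  qed
qed

section \<open>Covariances\<close>

text \<open>Stated for two arbitrary random variables, so that bilinearity permits differentiation
  in one argument while the other is frozen.\<close>

definition covar :: "'w measure \<Rightarrow> ('w \<Rightarrow> real) \<Rightarrow> ('w \<Rightarrow> real) \<Rightarrow> real" where
  "covar M f g = (\<integral>\<omega>. f \<omega> * g \<omega> \<partial>M) - (\<integral>\<omega>. f \<omega> \<partial>M) * (\<integral>\<omega>. g \<omega> \<partial>M)"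

lemma covar_commute: "covar M f g = covar M g f"
  by (simp add: covar_def mult.commute)

lemma covar_cmult_left: "covar M (\<lambda>\<omega>. c * f \<omega>) g = c * covar M f g"
  by (simp add: covar_def mult.assoc right_diff_distrib)

context prob_space
begin

lemma L2_fun_integrable: "f \<in> L2_fun M \<Longrightarrow> integrable M f"
  by (simp add: L2_fun_def square_integrable_imp_integrable)

lemma abs_expectation_le_L2_norm:
  assumes "f \<in> L2_fun M"
  shows "\<bar>\<integral>\<omega>. f \<omega> \<partial>M\<bar> \<le> L2_norm M f"
proof -
  have "(\<lambda>_. 1) \<in> L2_fun M"
    by (simp add: L2_fun_def)
  from L2_Cauchy_Schwarz[OF assms this] show ?thesis
    by (simp add: L2_norm_def prob_space)
qed

text \<open>The factor 2 collects one bound for the expectation of the product and one for the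
  product of the expectations.\<close>

lemma covar_le:
  assumes "f \<in> L2_fun M" "g \<in> L2_fun M"
  shows "\<bar>covar M f g\<bar> \<le> 2 * L2_norm M f * L2_norm M g"
proof -
  have "\<bar>(\<integral>\<omega>. f \<omega> \<partial>M) * (\<integral>\<omega>. g \<omega> \<partial>M)\<bar> \<le> L2_norm M f * L2_norm M g"
    unfolding abs_mult using assms by (intro mult_mono abs_expectation_le_L2_norm) (auto simp: L2_norm_nonneg)
  then show ?thesis
    using L2_Cauchy_Schwarz[OF assms] unfolding covar_def by simp
qed

lemma covar_diff_left:
  assumes "f \<in> L2_fun M" "g \<in> L2_fun M" "h \<in> L2_fun M"
  shows "covar M (\<lambda>\<omega>. f \<omega> - g \<omega>) h = covar M f h - covar M g h"
  using assms by (simp add: covar_def left_diff_distrib L2_fun_mult_integrable L2_fun_integrable)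

lemma covar_diff_right:
  assumes "f \<in> L2_fun M" "g \<in> L2_fun M" "h \<in> L2_fun M"
  shows "covar M h (\<lambda>\<omega>. f \<omega> - g \<omega>) = covar M h f - covar M h g"
  using covar_diff_left[OF assms] by (simp add: covar_commute)

text \<open>The arguments are exchanged one at a time, through \<open>covar M f' g\<close>. The form
  serves both continuity in the base point and the comparison of two representatives.\<close>

lemma covar_diff_le:
  assumes "f \<in> L2_fun M" "f' \<in> L2_fun M" "g \<in> L2_fun M" "g' \<in> L2_fun M"
  shows "\<bar>covar M f g - covar M f' g'\<bar> \<le>
    2 * L2_norm M (\<lambda>\<omega>. f \<omega> - f' \<omega>) * L2_norm M g + 2 * L2_norm M f' * L2_norm M (\<lambda>\<omega>. g \<omega> - g' \<omega>)"
proof -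
  have "covar M f g - covar M f' g' =
      covar M (\<lambda>\<omega>. f \<omega> - f' \<omega>) g + covar M f' (\<lambda>\<omega>. g \<omega> - g' \<omega>)"
    using assms by (simp add: covar_diff_left covar_diff_right)
  then show ?thesis
    using covar_le[OF L2_fun_diff[OF assms(1,2)] assms(3)] covar_le[OF assms(2) L2_fun_diff[OF assms(3,4)]]
    by linarith
qed

end


section \<open>Random fields that are smooth in the mean-square sense\<close>

definition field_deriv ::
  "('a::euclidean_space \<Rightarrow> nat) \<Rightarrow> ('a \<Rightarrow> 'w \<Rightarrow> real) \<Rightarrow> 'a \<Rightarrow> 'w \<Rightarrow> real" where
  "field_deriv \<alpha> A x \<omega> = mpartial \<alpha> (\<lambda>y. A y \<omega>) x"

text \<open>The conditions on a family at a single \<epsilon>, so that the analysis can be done for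
  one field. Measurability of the field itself is contained in the case of the zero
  multi-index.\<close>

definition L2_smooth_field :: "'w measure \<Rightarrow> ('a::euclidean_space \<Rightarrow> 'w \<Rightarrow> real) \<Rightarrow> bool" where
  "L2_smooth_field M A \<longleftrightarrow>
    (AE \<omega> in M. smooth (\<lambda>x. A x \<omega>)) \<and>
    (\<forall>x \<alpha>. field_deriv \<alpha> A x \<in> L2_fun M) \<and>
    (\<forall>K \<alpha>. compact K \<longrightarrow> bdd_above ((\<lambda>x. L2_norm M (field_deriv \<alpha> A x)) ` K))"

lemma field_L2_norm_eq: "field_L2_norm M \<alpha> A x = L2_norm M (field_deriv \<alpha> A x)"
  by (simp add: field_L2_norm_def field_deriv_def[abs_def])

lemma L2_smooth_field_L2_fun: "L2_smooth_field M A \<Longrightarrow> field_deriv \<alpha> A x \<in> L2_fun M"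
  by (simp add: L2_smooth_field_def)

lemma L2_smooth_field_bound:
  assumes "L2_smooth_field M A"
  obtains C where "0 \<le> C" "\<And>y. y \<in> cball x r \<Longrightarrow> L2_norm M (field_deriv \<alpha> A y) \<le> C"
proof -
  have "bdd_above ((\<lambda>x. L2_norm M (field_deriv \<alpha> A x)) ` cball x r)"
    using assms by (simp add: L2_smooth_field_def)
  then obtain C where "\<And>y. y \<in> cball x r \<Longrightarrow> L2_norm M (field_deriv \<alpha> A y) \<le> C"
    unfolding bdd_above_def by blast
  \<comment> \<open>For negative \<open>r\<close> the ball is empty and \<open>C\<close> may be
    negative, hence the maximum with 0.\<close>
  then show thesis
    by (intro that[of "max 0 C"]) fastforce+
qed

text \<open>The segment from \<open>x\<close> to \<open>x + t *\<^sub>R b\<close> is parametrised by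
  \<open>s\<close> in the unit interval. This treats both signs of \<open>t\<close> at once and
  exhibits the factor \<open>t\<close> that the increment estimates rely on.\<close>

lemma field_deriv_has_derivative:
  assumes "smooth (\<lambda>y. A y \<omega>)" "b \<in> Basis"
  shows "((\<lambda>s. field_deriv \<alpha> A (x + (s * t) *\<^sub>R b) \<omega>) has_real_derivative
    t * field_deriv (\<alpha>(b := Suc (\<alpha> b))) A (x + (s * t) *\<^sub>R b) \<omega>) (at s)"
proof -
  have "((\<lambda>r. field_deriv \<alpha> A (x + r *\<^sub>R b) \<omega>) has_real_derivative
      field_deriv (\<alpha>(b := Suc (\<alpha> b))) A (x + (s * t) *\<^sub>R b) \<omega>) (at (s * t))"
    using smooth_has_partial[OF smooth_mpartial[OF assms(1), of \<alpha>] assms(2)]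
    by (simp add: field_deriv_def partial_mpartial[OF assms])
  moreover have "((\<lambda>s. s * t) has_real_derivative t) (at s)"
    by (auto intro!: derivative_eq_intros)
  ultimately show ?thesis
    using DERIV_chain2 by (fastforce simp: mult.commute)
qed

lemma field_deriv_continuous:
  assumes "smooth (\<lambda>y. A y \<omega>)"
  shows "continuous_on S (\<lambda>s. field_deriv \<alpha> A (x + (s * t) *\<^sub>R b) \<omega>)"
  unfolding field_deriv_def
  by (rule continuous_on_compose2[OF smooth_imp_continuous[OF smooth_mpartial[OF assms], of UNIV]])
    (auto intro!: continuous_intros)

lemma field_increment_le:
  assumes A: "L2_smooth_field M A" and b: "b \<in> Basis"
    and le: "\<And>s. 0 \<le> s \<Longrightarrow> s \<le> 1 \<Longrightarrow> L2_norm M (field_deriv (\<alpha>(b := Suc (\<alpha> b))) A (x + (s * t) *\<^sub>R b)) \<le> C"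
  shows "L2_norm M (\<lambda>\<omega>. field_deriv \<alpha> A (x + t *\<^sub>R b) \<omega> - field_deriv \<alpha> A x \<omega>) \<le> \<bar>t\<bar> * C"
proof -
  let ?g = "\<lambda>s. field_deriv \<alpha> A (x + (s * t) *\<^sub>R b)"
  let ?g' = "\<lambda>s \<omega>. t * field_deriv (\<alpha>(b := Suc (\<alpha> b))) A (x + (s * t) *\<^sub>R b) \<omega>"
  have "AE \<omega> in M. smooth (\<lambda>x. A x \<omega>)"
    using A by (simp add: L2_smooth_field_def)
  then have "AE \<omega> in M. (\<forall>s. ((\<lambda>s. ?g s \<omega>) has_real_derivative ?g' s \<omega>) (at s)) \<and>
      continuous_on {0..1} (\<lambda>s. ?g' s \<omega>)"
    by eventually_elim (auto intro!: field_deriv_has_derivative b continuous_on_mult_left field_deriv_continuous)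
  then have "L2_norm M (\<lambda>\<omega>. ?g 1 \<omega> - ?g 0 \<omega>) \<le> \<bar>t\<bar> * C"
    using A le by (intro L2_norm_increment_le)
      (auto simp: L2_norm_cmult intro!: L2_fun_cmult L2_smooth_field_L2_fun mult_left_mono)
  then show ?thesis
    by simp
qed

text \<open>After the linear part is subtracted, the path derivative is \<open>t\<close> times an
  increment of the \<beta>-derivative, to which the first-order estimate applies; this yields the
  second factor \<open>t\<close>. Bounding uniformly in \<open>s\<close> instead of integrating
  loses the Taylor constant 1/2.\<close>

lemma field_second_increment_le:
  assumes A: "L2_smooth_field M A" and b: "b \<in> Basis" and \<beta>: "\<beta> = \<alpha>(b := Suc (\<alpha> b))"
    and le: "\<And>s. 0 \<le> s \<Longrightarrow> s \<le> 1 \<Longrightarrow> L2_norm M (field_deriv (\<beta>(b := Suc (\<beta> b))) A (x + (s * t) *\<^sub>R b)) \<le> C"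
  shows "L2_norm M (\<lambda>\<omega>. field_deriv \<alpha> A (x + t *\<^sub>R b) \<omega> - field_deriv \<alpha> A x \<omega> - t * field_deriv \<beta> A x \<omega>) \<le> t\<^sup>2 * C"
proof -
  let ?g = "\<lambda>s \<omega>. field_deriv \<alpha> A (x + (s * t) *\<^sub>R b) \<omega> - s * (t * field_deriv \<beta> A x \<omega>)"
  let ?g' = "\<lambda>s \<omega>. t * field_deriv \<beta> A (x + (s * t) *\<^sub>R b) \<omega> - t * field_deriv \<beta> A x \<omega>"
  have C: "0 \<le> C"
    using le[of 0] L2_norm_nonneg[of M "field_deriv (\<beta>(b := Suc (\<beta> b))) A x"] by simp
  have "AE \<omega> in M. smooth (\<lambda>x. A x \<omega>)"
    using A by (simp add: L2_smooth_field_def)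
  then have "AE \<omega> in M. (\<forall>s. ((\<lambda>s. ?g s \<omega>) has_real_derivative ?g' s \<omega>) (at s)) \<and>
      continuous_on {0..1} (\<lambda>s. ?g' s \<omega>)"
  proof eventually_elim
    case (elim \<omega>)
    have "((\<lambda>s. s * (t * field_deriv \<beta> A x \<omega>)) has_real_derivative t * field_deriv \<beta> A x \<omega>) (at s)" for s
      by (auto intro!: derivative_eq_intros)
    then show ?case
      using elim b unfolding \<beta>
      by (auto intro!: DERIV_diff field_deriv_has_derivative continuous_on_diff
          continuous_on_mult_left field_deriv_continuous)
  qed
  moreover have "L2_norm M (?g' s) \<le> t\<^sup>2 * C" if s: "0 \<le> s" "s \<le> 1" for s
  proof -
    have "L2_norm M (\<lambda>\<omega>. field_deriv \<beta> A (x + (s * t) *\<^sub>R b) \<omega> - field_deriv \<beta> A x \<omega>) \<le> \<bar>s * t\<bar> * C"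
    proof (rule field_increment_le[OF A b])
      fix r :: real
      assume "0 \<le> r" "r \<le> 1"
      \<comment> \<open>Parameter \<open>r\<close> on the shorter segment is parameter
        \<open>r * s\<close> on the full one, where the bound is assumed.\<close>
      then show "L2_norm M (field_deriv (\<beta>(b := Suc (\<beta> b))) A (x + (r * (s * t)) *\<^sub>R b)) \<le> C"
        using le[of "r * s"] s by (simp add: mult_le_one mult.assoc)
    qed
    also have "\<dots> \<le> \<bar>t\<bar> * C"
      using s C by (intro mult_right_mono) (auto simp: abs_mult mult_left_le_one_le)
    finally have "\<bar>t\<bar> * L2_norm M (\<lambda>\<omega>. field_deriv \<beta> A (x + (s * t) *\<^sub>R b) \<omega> - field_deriv \<beta> A x \<omega>) \<le> \<bar>t\<bar> * (\<bar>t\<bar> * C)"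
      by (intro mult_left_mono) auto
    then show ?thesis
      by (simp add: L2_norm_cmult[symmetric] right_diff_distrib power2_eq_square mult.assoc[symmetric])
  qed
  ultimately have "L2_norm M (\<lambda>\<omega>. ?g 1 \<omega> - ?g 0 \<omega>) \<le> t\<^sup>2 * C"
    using A by (intro L2_norm_increment_le) (auto intro!: L2_fun_diff L2_fun_cmult L2_smooth_field_L2_fun)
  then show ?thesis
    by (simp add: algebra_simps)
qed

text \<open>The increments are taken along one coordinate direction at a time, hence the bounds on
  a ball whose radius is the dimension.\<close>

lemma field_Lipschitz:
  fixes A :: "'a::euclidean_space \<Rightarrow> 'w \<Rightarrow> real"
  assumes A: "L2_smooth_field M A"
  obtains C where "\<And>y. norm (y - x) \<le> 1 \<Longrightarrow>
    L2_norm M (\<lambda>\<omega>. field_deriv \<alpha> A y \<omega> - field_deriv \<alpha> A x \<omega>) \<le> C * norm (y - x)"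
proof -
  let ?n = "real DIM('a)"
  have "\<forall>b. \<exists>C\<ge>0. \<forall>y\<in>cball x ?n. L2_norm M (field_deriv (\<alpha>(b := Suc (\<alpha> b))) A y) \<le> C"
    by (meson L2_smooth_field_bound[OF A])
  then obtain C where C: "\<And>b. 0 \<le> C b"
    "\<And>b y. y \<in> cball x ?n \<Longrightarrow> L2_norm M (field_deriv (\<alpha>(b := Suc (\<alpha> b))) A y) \<le> C b"
    by metis
  have "L2_norm M (\<lambda>\<omega>. field_deriv \<alpha> A y \<omega> - field_deriv \<alpha> A x \<omega>) \<le> (\<Sum>b\<in>Basis. C b) * norm (y - x)"
    if y: "norm (y - x) \<le> 1" for y
  proof -
    \<comment> \<open>Only the coordinates in \<open>S\<close> have been moved from \<open>x\<close>
      to \<open>y\<close>; enlarging \<open>S\<close> by one basis vector is one coordinate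
      step.\<close>
    define p where "p S = x + (\<Sum>b\<in>S. ((y - x) \<bullet> b) *\<^sub>R b)" for S
    have "L2_norm M (\<lambda>\<omega>. field_deriv \<alpha> A (p S) \<omega> - field_deriv \<alpha> A x \<omega>) \<le> (\<Sum>b\<in>S. C b) * norm (y - x)"
      if "finite S" "S \<subseteq> Basis" for S
      using that
    proof (induction S)
      case empty
      then show ?case by (simp add: p_def L2_norm_zero)
    next
      case (insert b S)
      let ?t = "(y - x) \<bullet> b"
      have t: "\<bar>?t\<bar> \<le> norm (y - x)"
        using insert.prems by (simp add: Basis_le_norm)
      have p: "p (insert b S) = p S + ?t *\<^sub>R b"
        using insert.hyps by (simp add: p_def add_ac)
      \<comment> \<open>The \<open>card S\<close> completed moves and the current one each have
        length at most 1, and there are at most as many moves as basis vectors.\<close>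
      have "p S + (s * ?t) *\<^sub>R b \<in> cball x ?n" if s: "0 \<le> s" "s \<le> 1" for s
      proof -
        have "norm ((s * ?t) *\<^sub>R b) \<le> 1"
          using t y s insert.prems by (auto simp: abs_mult intro!: mult_le_one)
        moreover have "norm (\<Sum>b\<in>S. ((y - x) \<bullet> b) *\<^sub>R b) \<le> (\<Sum>b\<in>S. 1)"
          using insert.prems y
          by (intro order_trans[OF norm_sum] sum_mono) (force intro: order_trans[OF Basis_le_norm])
        ultimately have "norm ((\<Sum>b\<in>S. ((y - x) \<bullet> b) *\<^sub>R b) + (s * ?t) *\<^sub>R b) \<le> real (card S) + 1"
          using norm_triangle_ineq[of "\<Sum>b\<in>S. ((y - x) \<bullet> b) *\<^sub>R b" "(s * ?t) *\<^sub>R b"] by simp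
        also have "real (card S) + 1 = real (card (insert b S))"
          using insert.hyps by simp
        also have "\<dots> \<le> ?n"
          using insert.prems by (simp only: of_nat_le_iff) (intro card_mono finite_Basis)
        finally show ?thesis
          unfolding mem_cball dist_commute[of x] by (simp add: p_def dist_norm add_ac)
      qed
      then have "L2_norm M (\<lambda>\<omega>. field_deriv \<alpha> A (p (insert b S)) \<omega> - field_deriv \<alpha> A (p S) \<omega>) \<le> \<bar>?t\<bar> * C b"
        unfolding p using insert.prems by (intro field_increment_le[OF A] C(2)) auto
      also have "\<dots> \<le> C b * norm (y - x)"
        using t C(1)[of b] by (simp add: mult.commute mult_left_mono)
      finally have "L2_norm M (\<lambda>\<omega>. field_deriv \<alpha> A (p (insert b S)) \<omega> - field_deriv \<alpha> A (p S) \<omega>) \<le> C b * norm (y - x)" .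
      moreover have "L2_norm M (\<lambda>\<omega>. (field_deriv \<alpha> A (p (insert b S)) \<omega> - field_deriv \<alpha> A (p S) \<omega>) +
          (field_deriv \<alpha> A (p S) \<omega> - field_deriv \<alpha> A x \<omega>)) \<le>
        L2_norm M (\<lambda>\<omega>. field_deriv \<alpha> A (p (insert b S)) \<omega> - field_deriv \<alpha> A (p S) \<omega>) +
        L2_norm M (\<lambda>\<omega>. field_deriv \<alpha> A (p S) \<omega> - field_deriv \<alpha> A x \<omega>)"
        by (intro L2_norm_add L2_fun_diff L2_smooth_field_L2_fun A)
      ultimately show ?case
        using insert by (simp add: distrib_right)
    qed
    moreover have "p Basis = y"
      by (simp add: p_def euclidean_representation)
    ultimately show ?thesis
      by (metis finite_Basis order_refl)
  qed
  then show thesis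
    by (rule that)
qed

text \<open>The filter is \<open>nhds x\<close> rather than \<open>at x\<close> because the limit is
  composed with projections: a component of \<open>w\<close> may equal that of \<open>z\<close>
  although \<open>w\<close> differs from \<open>z\<close>.\<close>

lemma field_L2_tendsto:
  assumes "L2_smooth_field M A"
  shows "((\<lambda>y. L2_norm M (\<lambda>\<omega>. field_deriv \<alpha> A y \<omega> - field_deriv \<alpha> A x \<omega>)) \<longlongrightarrow> 0) (nhds x)"
proof -
  obtain C where C: "\<And>y. norm (y - x) \<le> 1 \<Longrightarrow>
      L2_norm M (\<lambda>\<omega>. field_deriv \<alpha> A y \<omega> - field_deriv \<alpha> A x \<omega>) \<le> C * norm (y - x)"
    using field_Lipschitz[OF assms] by metis
  show ?thesis
  proof (rule Lim_null_comparison)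
    have "\<forall>\<^sub>F y in nhds x. dist y x < 1"
      by (simp add: eventually_nhds_metric) (meson zero_less_one)
    then show "\<forall>\<^sub>F y in nhds x. norm (L2_norm M (\<lambda>\<omega>. field_deriv \<alpha> A y \<omega> - field_deriv \<alpha> A x \<omega>)) \<le> C * norm (y - x)"
      by eventually_elim (simp add: C dist_norm L2_norm_nonneg)
    show "((\<lambda>y. C * norm (y - x)) \<longlongrightarrow> 0) (nhds x)"
      by (auto intro!: tendsto_eq_intros filterlim_ident)
  qed
qed

section \<open>Differentiating a covariance in one argument\<close>

context prob_space
begin

text \<open>By linearity the covariance of the Taylor remainder with \<open>Y\<close> is
  \<open>t\<close> times the error of the difference quotient. The remainder is of order
  \<open>t\<^sup>2\<close>, so an error of order \<open>\<bar>t\<bar>\<close> remains after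
  division.\<close>

lemma covar_field_has_derivative:
  assumes A: "L2_smooth_field M A" and b: "b \<in> Basis" and Y: "Y \<in> L2_fun M"
  shows "((\<lambda>t. covar M (field_deriv \<alpha> A (x + t *\<^sub>R b)) Y) has_real_derivative
    covar M (field_deriv (\<alpha>(b := Suc (\<alpha> b))) A x) Y) (at 0)"
proof -
  let ?\<beta> = "\<alpha>(b := Suc (\<alpha> b))"
  let ?D = "\<lambda>t \<omega>. field_deriv \<alpha> A (x + t *\<^sub>R b) \<omega> - field_deriv \<alpha> A x \<omega> - t * field_deriv ?\<beta> A x \<omega>"
  note L2 = L2_smooth_field_L2_fun[OF A]
  obtain C where C: "0 \<le> C"
    "\<And>y. y \<in> cball x 1 \<Longrightarrow> L2_norm M (field_deriv (?\<beta>(b := Suc (?\<beta> b))) A y) \<le> C"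
    using L2_smooth_field_bound[OF A] by metis
  have le: "L2_norm M (?D t) \<le> t\<^sup>2 * C" if t: "\<bar>t\<bar> \<le> 1" for t
  proof (rule field_second_increment_le[OF A b refl])
    fix s :: real
    assume "0 \<le> s" "s \<le> 1"
    then show "L2_norm M (field_deriv (?\<beta>(b := Suc (?\<beta> b))) A (x + (s * t) *\<^sub>R b)) \<le> C"
      using t b by (intro C(2)) (simp add: dist_norm abs_mult mult_le_one)
  qed
  let ?q = "\<lambda>t. (covar M (field_deriv \<alpha> A (x + t *\<^sub>R b)) Y - covar M (field_deriv \<alpha> A x) Y) / t"
  have "((\<lambda>t. ?q t - covar M (field_deriv ?\<beta> A x) Y) \<longlongrightarrow> 0) (at 0)"
  proof (rule Lim_null_comparison)
    show "((\<lambda>t. \<bar>t\<bar> * (2 * C * L2_norm M Y)) \<longlongrightarrow> 0) (at 0)"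
      by (auto intro!: tendsto_eq_intros)
    have "\<forall>\<^sub>F t in at (0::real). t \<noteq> 0 \<and> dist t 0 < 1"
      by (auto simp: eventually_at intro: exI[of _ 1])
    then show "\<forall>\<^sub>F t in at 0. norm (?q t - covar M (field_deriv ?\<beta> A x) Y) \<le> \<bar>t\<bar> * (2 * C * L2_norm M Y)"
    proof eventually_elim
      case (elim t)
      have "covar M (?D t) Y = covar M (field_deriv \<alpha> A (x + t *\<^sub>R b)) Y - covar M (field_deriv \<alpha> A x) Y -
          t * covar M (field_deriv ?\<beta> A x) Y"
        by (simp add: covar_diff_left covar_cmult_left L2_fun_diff L2_fun_cmult L2 Y)
      also have "\<dots> = t * (?q t - covar M (field_deriv ?\<beta> A x) Y)"
        using elim by (simp add: field_simps)
      finally have "covar M (?D t) Y = t * (?q t - covar M (field_deriv ?\<beta> A x) Y)" .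
      then have "\<bar>t\<bar> * \<bar>?q t - covar M (field_deriv ?\<beta> A x) Y\<bar> \<le> 2 * L2_norm M (?D t) * L2_norm M Y"
        using covar_le[of "?D t" Y] by (simp add: abs_mult L2_fun_diff L2_fun_cmult L2 Y)
      also have "\<dots> \<le> 2 * (t\<^sup>2 * C) * L2_norm M Y"
        using elim by (intro mult_right_mono mult_left_mono le) (auto simp: L2_norm_nonneg)
      also have "\<dots> = \<bar>t\<bar> * (\<bar>t\<bar> * (2 * C * L2_norm M Y))"
        by (simp add: power2_eq_square abs_mult[symmetric])
      finally show ?case
        using elim by simp
    qed
  qed
  then show ?thesis
    by (simp add: DERIV_def LIM_zero_iff)
qed

end

text \<open>Covariances of two derivatives of the same field form a class that contains the
  autocovariance and is closed under partial derivatives on the product space.\<close>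

definition field_covar :: "'w measure \<Rightarrow> ('a::euclidean_space \<Rightarrow> nat) \<Rightarrow> ('a \<Rightarrow> nat) \<Rightarrow>
    ('a \<Rightarrow> 'w \<Rightarrow> real) \<Rightarrow> 'a \<times> 'a \<Rightarrow> real" where
  "field_covar M \<alpha> \<beta> A z = covar M (field_deriv \<alpha> A (fst z)) (field_deriv \<beta> A (snd z))"

text \<open>Brings the second variable into the left argument, so that the derivative computed there
  serves both variables.\<close>

lemma field_covar_swap:
  "field_covar M \<alpha> \<beta> A z = covar M (field_deriv \<beta> A (snd z)) (field_deriv \<alpha> A (fst z))"
  unfolding field_covar_def by (rule covar_commute)

lemma autocov_eq: "autocov M U \<epsilon> = field_covar M (\<lambda>_. 0) (\<lambda>_. 0) (U \<epsilon>)"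
  by (auto simp: fun_eq_iff autocov_def field_covar_def covar_def field_deriv_def mpartial_zero)

context prob_space
begin

lemma field_covar_continuous:
  assumes A: "L2_smooth_field M A"
  shows "continuous_on UNIV (field_covar M \<alpha> \<beta> A)"
proof -
  note L2 = L2_smooth_field_L2_fun[OF A]
  have "(field_covar M \<alpha> \<beta> A \<longlongrightarrow> field_covar M \<alpha> \<beta> A z) (at z)" for z
  proof -
    let ?N = "\<lambda>\<alpha> x y. L2_norm M (\<lambda>\<omega>. field_deriv \<alpha> A y \<omega> - field_deriv \<alpha> A x \<omega>)"
    \<comment> \<open>In \<open>covar_diff_le\<close> the factor \<open>g\<close> sits at the moving
      point, so its norm must be bounded near \<open>z\<close>; the norm of \<open>f'\<close> is
      taken at the fixed point.\<close>
    obtain C where C: "0 \<le> C"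
      "\<And>y. y \<in> cball (snd z) 1 \<Longrightarrow> L2_norm M (field_deriv \<beta> A y) \<le> C"
      using L2_smooth_field_bound[OF A] by metis
    let ?B = "\<lambda>w. 2 * ?N \<alpha> (fst z) (fst w) * C +
      2 * L2_norm M (field_deriv \<alpha> A (fst z)) * ?N \<beta> (snd z) (snd w)"
    have "((\<lambda>w. field_covar M \<alpha> \<beta> A w - field_covar M \<alpha> \<beta> A z) \<longlongrightarrow> 0) (at z)"
    proof (rule Lim_null_comparison)
      have "((\<lambda>w. ?N \<alpha> (fst z) (fst w)) \<longlongrightarrow> 0) (at z)"
        by (intro filterlim_compose[OF field_L2_tendsto[OF A]] tendsto_fst tendsto_ident_at)
      moreover have "((\<lambda>w. ?N \<beta> (snd z) (snd w)) \<longlongrightarrow> 0) (at z)"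
        by (intro filterlim_compose[OF field_L2_tendsto[OF A]] tendsto_snd tendsto_ident_at)
      ultimately show "(?B \<longlongrightarrow> 0) (at z)"
        by (auto intro!: tendsto_eq_intros)
      have "\<forall>\<^sub>F w in at z. dist w z < 1"
        by (auto simp: eventually_at intro: exI[of _ 1])
      then show "\<forall>\<^sub>F w in at z. norm (field_covar M \<alpha> \<beta> A w - field_covar M \<alpha> \<beta> A z) \<le> ?B w"
      proof eventually_elim
        case (elim w)
        then have "dist (snd w) (snd z) \<le> 1"
          using dist_snd_le[of w z] by linarith
        then have "L2_norm M (field_deriv \<beta> A (snd w)) \<le> C"
          by (intro C(2)) (simp add: dist_commute)
        then have "2 * ?N \<alpha> (fst z) (fst w) * L2_norm M (field_deriv \<beta> A (snd w)) \<le> 2 * ?N \<alpha> (fst z) (fst w) * C"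
          by (intro mult_left_mono) (auto simp: L2_norm_nonneg)
        then show ?case
          using covar_diff_le[OF L2 L2 L2 L2, of \<alpha> "fst w" \<beta> "snd w" \<alpha> "fst z" \<beta> "snd z"]
          by (simp add: field_covar_def)
      qed
    qed
    then show ?thesis
      by (rule LIM_zero_cancel)
  qed
  then show ?thesis
    by (simp add: continuous_on_eq_continuous_at isCont_def)
qed

text \<open>Throughout, the new pair of multi-indices does not depend on the field, which makes the
  estimates below uniform in \<open>\<epsilon>\<close>.\<close>

lemma field_covar_has_partial:
  fixes \<alpha> \<beta> :: "'c::euclidean_space \<Rightarrow> nat"
  assumes p: "p \<in> Basis"
  shows "\<exists>\<alpha>' \<beta>'. \<forall>A z. L2_smooth_field M A \<longrightarrow>
    ((\<lambda>t. field_covar M \<alpha> \<beta> A (z + t *\<^sub>R p)) has_real_derivative field_covar M \<alpha>' \<beta>' A z) (at 0)"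
proof -
  from p consider b where "b \<in> Basis" "p = (b, 0)" | b where "b \<in> Basis" "p = (0, b)"
    unfolding Basis_prod_def by auto
  then show ?thesis
  proof cases
    case 1
    then show ?thesis
      by (intro exI[of _ "\<alpha>(b := Suc (\<alpha> b))"] exI[of _ \<beta>])
        (auto simp: field_covar_def intro!: covar_field_has_derivative L2_smooth_field_L2_fun)
  next
    case 2
    then show ?thesis
      by (intro exI[of _ \<alpha>] exI[of _ "\<beta>(b := Suc (\<beta> b))"])
        (auto simp: field_covar_swap intro!: covar_field_has_derivative L2_smooth_field_L2_fun)
  qed
qed

text \<open>Induction on the order works with both multi-indices generalised, since each partial
  derivative is again a function of the same class.\<close>

lemma field_covar_smooth:
  assumes A: "L2_smooth_field M A"
  shows "smooth (field_covar M \<alpha> \<beta> A)"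
proof -
  have "C_diff k (field_covar M \<alpha> \<beta> A)" for k
  proof (induction k arbitrary: \<alpha> \<beta>)
    case 0
    show ?case
      by (simp add: field_covar_continuous A)
  next
    case (Suc k)
    have "(\<forall>z. (\<lambda>t. field_covar M \<alpha> \<beta> A (z + t *\<^sub>R p)) field_differentiable at 0) \<and>
        C_diff k (partial p (field_covar M \<alpha> \<beta> A))" if p: "p \<in> Basis" for p
    proof -
      obtain \<alpha>' \<beta>' where der: "\<And>z. ((\<lambda>t. field_covar M \<alpha> \<beta> A (z + t *\<^sub>R p)) has_real_derivative
          field_covar M \<alpha>' \<beta>' A z) (at 0)"
        using field_covar_has_partial[OF p] A by meson
      then have "partial p (field_covar M \<alpha> \<beta> A) = field_covar M \<alpha>' \<beta>' A"
        by (intro ext partial_eqI)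
      then show ?thesis
        using der Suc by (auto simp: field_differentiable_def)
    qed
    then show ?case
      by (simp add: field_covar_continuous A)
  qed
  then show ?thesis
    by (simp add: smooth_def)
qed

lemma fold_partial_field_covar:
  fixes \<alpha> \<beta> :: "'c::euclidean_space \<Rightarrow> nat"
  assumes "set ps \<subseteq> Basis"
  shows "\<exists>\<alpha>' \<beta>'. \<forall>A. L2_smooth_field M A \<longrightarrow>
    fold (\<lambda>b. partial b ^^ \<gamma> b) ps (field_covar M \<alpha> \<beta> A) = field_covar M \<alpha>' \<beta>' A"
  using assms
proof (induction ps arbitrary: \<alpha> \<beta>)
  case Nil
  then show ?case by auto
next
  case (Cons p ps)
  have "\<exists>\<alpha>' \<beta>'. \<forall>A. L2_smooth_field M A \<longrightarrow>
      (partial p ^^ n) (field_covar M \<alpha> \<beta> A) = field_covar M \<alpha>' \<beta>' A" for n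
  proof (induction n)
    case 0
    then show ?case by auto
  next
    case (Suc n)
    then obtain \<alpha>1 \<beta>1 where "\<And>A. L2_smooth_field M A \<Longrightarrow>
        (partial p ^^ n) (field_covar M \<alpha> \<beta> A) = field_covar M \<alpha>1 \<beta>1 A"
      by blast
    moreover obtain \<alpha>2 \<beta>2 where "\<And>A z. L2_smooth_field M A \<Longrightarrow>
        ((\<lambda>t. field_covar M \<alpha>1 \<beta>1 A (z + t *\<^sub>R p)) has_real_derivative field_covar M \<alpha>2 \<beta>2 A z) (at 0)"
      using field_covar_has_partial[of p \<alpha>1 \<beta>1] Cons.prems by (metis list.set_intros(1) subsetD)
    ultimately show ?case
      by (intro exI[of _ \<alpha>2] exI[of _ \<beta>2]) (auto intro!: ext partial_eqI)
  qed
  then obtain \<alpha>1 \<beta>1 where 1: "\<And>A. L2_smooth_field M A \<Longrightarrow>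
      (partial p ^^ \<gamma> p) (field_covar M \<alpha> \<beta> A) = field_covar M \<alpha>1 \<beta>1 A"
    by meson
  obtain \<alpha>2 \<beta>2 where "\<And>A. L2_smooth_field M A \<Longrightarrow>
      fold (\<lambda>b. partial b ^^ \<gamma> b) ps (field_covar M \<alpha>1 \<beta>1 A) = field_covar M \<alpha>2 \<beta>2 A"
    using Cons.IH[of \<alpha>1 \<beta>1] Cons.prems by auto
  then show ?case
    using 1 by (intro exI[of _ \<alpha>2] exI[of _ \<beta>2]) simp
qed

lemma mpartial_field_covar:
  fixes \<alpha> \<beta> :: "'c::euclidean_space \<Rightarrow> nat"
  obtains \<alpha>' \<beta>' where
    "\<And>A. L2_smooth_field M A \<Longrightarrow> mpartial \<gamma> (field_covar M \<alpha> \<beta> A) = field_covar M \<alpha>' \<beta>' A"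
  using fold_partial_field_covar[of basis_list \<gamma> \<alpha> \<beta>] unfolding mpartial_def by (auto simp: basis_list(2))

end


section \<open>Moderate and negligible families\<close>

lemma eventually_unit_interval: "\<forall>\<^sub>F \<epsilon> in at_right 0. \<epsilon> \<in> {0<..1::real}"
  using eventually_at_right[of 0 "1::real"] by (auto intro!: exI[of _ 1])

text \<open>Comparison is demanded only on the unit interval, since families are unconstrained
  elsewhere. Absolute values on both sides avoid sign conditions.\<close>

lemma bigo_le_on_unit_interval:
  fixes r s :: "real \<Rightarrow> real"
  assumes "s \<in> O[at_right 0](f)" "\<And>\<epsilon>. \<epsilon> \<in> {0<..1} \<Longrightarrow> \<bar>r \<epsilon>\<bar> \<le> \<bar>s \<epsilon>\<bar>"
  shows "r \<in> O[at_right 0](f)"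
proof -
  have "\<forall>\<^sub>F \<epsilon> in at_right 0. norm (r \<epsilon>) \<le> norm (s \<epsilon>)"
    using eventually_unit_interval by eventually_elim (simp add: assms(2))
  then have "r \<in> O[at_right 0](s)"
    by (rule landau_o.big_mono)
  then show ?thesis
    using assms(1) by (rule landau_o.big_trans)
qed

lemma moderate_le:
  "moderate s \<Longrightarrow> (\<And>\<epsilon>. \<epsilon> \<in> {0<..1} \<Longrightarrow> \<bar>r \<epsilon>\<bar> \<le> \<bar>s \<epsilon>\<bar>) \<Longrightarrow> moderate r"
  unfolding moderate_def by (meson bigo_le_on_unit_interval)

lemma negligible_family_le:
  "negligible_family s \<Longrightarrow> (\<And>\<epsilon>. \<epsilon> \<in> {0<..1} \<Longrightarrow> \<bar>r \<epsilon>\<bar> \<le> \<bar>s \<epsilon>\<bar>) \<Longrightarrow> negligible_family r"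
  unfolding negligible_family_def by (meson bigo_le_on_unit_interval)

lemma moderate_cmult: "moderate r \<Longrightarrow> moderate (\<lambda>\<epsilon>. c * r \<epsilon>)"
  unfolding moderate_def by (cases "c = 0") auto

lemma negligible_family_cmult: "negligible_family r \<Longrightarrow> negligible_family (\<lambda>\<epsilon>. c * r \<epsilon>)"
  unfolding negligible_family_def by (cases "c = 0") simp_all

lemma moderate_mult:
  assumes "moderate r" "moderate s"
  shows "moderate (\<lambda>\<epsilon>. r \<epsilon> * s \<epsilon>)"
proof -
  obtain a b where "a \<ge> 0" "b \<ge> 0" and O: "r \<in> O[at_right 0](\<lambda>\<epsilon>. \<epsilon> powr (- a))" "s \<in> O[at_right 0](\<lambda>\<epsilon>. \<epsilon> powr (- b))"
    using assms by (auto simp: moderate_def)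
  have "(\<lambda>\<epsilon>. r \<epsilon> * s \<epsilon>) \<in> O[at_right 0](\<lambda>\<epsilon>. \<epsilon> powr (- (a + b)))"
    using landau_o.big.mult[OF O] by (simp add: powr_add[symmetric] mult.assoc)
  then show ?thesis
    unfolding moderate_def using \<open>a \<ge> 0\<close> \<open>b \<ge> 0\<close> by (intro exI[of _ "a + b"]) auto
qed

lemma negligible_family_mult:
  assumes "negligible_family r" "moderate s"
  shows "negligible_family (\<lambda>\<epsilon>. r \<epsilon> * s \<epsilon>)"
  unfolding negligible_family_def
proof (intro allI impI)
  fix b :: real
  assume "b \<ge> 0"
  obtain a where "a \<ge> 0" and s: "s \<in> O[at_right 0](\<lambda>\<epsilon>. \<epsilon> powr (- a))"
    using assms(2) by (auto simp: moderate_def)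
  \<comment> \<open>Negligibility is invoked at the order raised by \<open>a\<close>, which pays for
    the growth of \<open>s\<close>.\<close>
  have "r \<in> O[at_right 0](\<lambda>\<epsilon>. \<epsilon> powr (b + a))"
    using assms(1) \<open>a \<ge> 0\<close> \<open>b \<ge> 0\<close> by (simp add: negligible_family_def)
  from landau_o.big.mult[OF this s]
  show "(\<lambda>\<epsilon>. r \<epsilon> * s \<epsilon>) \<in> O[at_right 0](\<lambda>\<epsilon>. \<epsilon> powr b)"
    by (simp add: powr_add[symmetric] mult.assoc)
qed

lemma negligible_family_add:
  "negligible_family r \<Longrightarrow> negligible_family s \<Longrightarrow> negligible_family (\<lambda>\<epsilon>. r \<epsilon> + s \<epsilon>)"
  unfolding negligible_family_def by (auto intro: sum_in_bigo)

lemma negligible_family_zero: "negligible_family (\<lambda>_. 0)"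
  by (simp add: negligible_family_def)

text \<open>A member of \<open>K\<close> shows that the supremum is nonnegative, and
  \<open>B\<close> makes it a genuine supremum of a bounded set.\<close>

lemma abs_SUP_le:
  fixes F :: "'a \<Rightarrow> real"
  assumes "K \<noteq> {}" "\<And>z. z \<in> K \<Longrightarrow> \<bar>F z\<bar> \<le> B"
  shows "\<bar>SUP z\<in>K. \<bar>F z\<bar>\<bar> \<le> \<bar>B\<bar>"
proof -
  obtain z where "z \<in> K"
    using assms(1) by blast
  then have "\<bar>F z\<bar> \<le> (SUP z\<in>K. \<bar>F z\<bar>)"
    using assms(2) by (intro cSUP_upper) (auto simp: bdd_above_def)
  moreover have "(SUP z\<in>K. \<bar>F z\<bar>) \<le> B"
    using assms by (intro cSUP_least)
  ultimately show ?thesis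
    by linarith
qed


section \<open>Equality in the Colombeau algebra\<close>

text \<open>Differences of derivatives replace derivatives of differences, which reduces symmetry
  and transitivity to properties of the absolute value.\<close>

lemma colombeau_rel_iff:
  "(u, v) \<in> colombeau_rel \<longleftrightarrow> u \<in> EM \<and> v \<in> EM \<and>
    (\<forall>K \<alpha>. compact K \<longrightarrow> K \<noteq> {} \<longrightarrow>
      negligible_family (\<lambda>\<epsilon>. SUP x\<in>K. \<bar>mpartial \<alpha> (u \<epsilon>) x - mpartial \<alpha> (v \<epsilon>) x\<bar>))"
proof (cases "u \<in> EM \<and> v \<in> EM")
  case True
  then have smooth: "smooth (u \<epsilon>)" "smooth (v \<epsilon>)" if "\<epsilon> \<in> {0<..1}" for \<epsilon>
    using that by (auto simp: EM_def)
  have eq: "(SUP x\<in>K. \<bar>mpartial \<alpha> (\<lambda>x. u \<epsilon> x - v \<epsilon> x) x\<bar>) =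
      (SUP x\<in>K. \<bar>mpartial \<alpha> (u \<epsilon>) x - mpartial \<alpha> (v \<epsilon>) x\<bar>)" if "\<epsilon> \<in> {0<..1}" for \<epsilon> K \<alpha>
    using smooth[OF that] by (simp add: mpartial_diff)
  have "negligible_family (\<lambda>\<epsilon>. SUP x\<in>K. \<bar>mpartial \<alpha> (\<lambda>x. u \<epsilon> x - v \<epsilon> x) x\<bar>) \<longleftrightarrow>
      negligible_family (\<lambda>\<epsilon>. SUP x\<in>K. \<bar>mpartial \<alpha> (u \<epsilon>) x - mpartial \<alpha> (v \<epsilon>) x\<bar>)" for K \<alpha>
    \<comment> \<open>The two suprema agree only for \<epsilon> in the unit interval, so the
      families are compared rather than rewritten.\<close>
    using eq by (auto elim!: negligible_family_le)
  then show ?thesis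
    using True smooth by (simp add: colombeau_rel_def Null_def smooth_diff)
qed (auto simp: colombeau_rel_def)

lemma equiv_colombeau_rel: "equiv EM (colombeau_rel :: ((real \<Rightarrow> 'a::euclidean_space \<Rightarrow> real) \<times> _) set)"
proof (rule equivI)
  show "colombeau_rel \<subseteq> (EM \<times> EM :: ((real \<Rightarrow> 'a \<Rightarrow> real) \<times> _) set)"
    by (auto simp: colombeau_rel_def)
  show "refl_on EM (colombeau_rel :: ((real \<Rightarrow> 'a \<Rightarrow> real) \<times> _) set)"
    by (auto simp: refl_on_def colombeau_rel_iff negligible_family_zero)
  show "sym (colombeau_rel :: ((real \<Rightarrow> 'a \<Rightarrow> real) \<times> _) set)"
    by (auto simp: sym_def colombeau_rel_iff abs_minus_commute)
  show "trans (colombeau_rel :: ((real \<Rightarrow> 'a \<Rightarrow> real) \<times> _) set)"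
  proof (rule transI)
    fix u v w :: "real \<Rightarrow> 'a \<Rightarrow> real"
    assume uv: "(u, v) \<in> colombeau_rel" and vw: "(v, w) \<in> colombeau_rel"
    show "(u, w) \<in> colombeau_rel"
      unfolding colombeau_rel_iff
    proof (intro conjI allI impI)
      fix K :: "'a set" and \<alpha>
      assume K: "compact K" "K \<noteq> {}"
      let ?S = "\<lambda>u v \<epsilon>. SUP x\<in>K. \<bar>mpartial \<alpha> (u \<epsilon>) x - mpartial \<alpha> (v \<epsilon>) x\<bar>"
      \<comment> \<open>The triangle inequality passes to suprema only if these are finite;
        continuity of the derivatives on the compact set provides this.\<close>
      have upper: "\<bar>mpartial \<alpha> (u \<epsilon>) x - mpartial \<alpha> (v \<epsilon>) x\<bar> \<le> ?S u v \<epsilon>"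
        if "\<epsilon> \<in> {0<..1}" "x \<in> K" "u \<in> EM" "v \<in> EM" for u v :: "real \<Rightarrow> 'a \<Rightarrow> real" and \<epsilon> x
      proof (rule cSUP_upper)
        have "continuous_on K (\<lambda>x. \<bar>mpartial \<alpha> (u \<epsilon>) x - mpartial \<alpha> (v \<epsilon>) x\<bar>)"
          using that by (intro continuous_intros smooth_imp_continuous smooth_mpartial) (auto simp: EM_def)
        then show "bdd_above ((\<lambda>x. \<bar>mpartial \<alpha> (u \<epsilon>) x - mpartial \<alpha> (v \<epsilon>) x\<bar>) ` K)"
          using K by (intro bounded_imp_bdd_above compact_imp_bounded compact_continuous_image)
      qed fact
      have "negligible_family (\<lambda>\<epsilon>. ?S u v \<epsilon> + ?S v w \<epsilon>)"
        using uv vw K by (intro negligible_family_add) (auto simp: colombeau_rel_iff)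
      then show "negligible_family (?S u w)"
      proof (rule negligible_family_le)
        fix \<epsilon> :: real
        assume \<epsilon>: "\<epsilon> \<in> {0<..1}"
        have "\<bar>mpartial \<alpha> (u \<epsilon>) x - mpartial \<alpha> (w \<epsilon>) x\<bar> \<le> ?S u v \<epsilon> + ?S v w \<epsilon>" if "x \<in> K" for x
          using upper[OF \<epsilon> that, of u v] upper[OF \<epsilon> that, of v w] uv vw
          by (simp add: colombeau_rel_iff)
        then show "\<bar>?S u w \<epsilon>\<bar> \<le> \<bar>?S u v \<epsilon> + ?S v w \<epsilon>\<bar>"
          by (intro abs_SUP_le K)
      qed
    qed (use uv vw in \<open>auto simp: colombeau_rel_iff\<close>)
  qed
qed


section \<open>The autocovariance of a generalized random field\<close>

lemma L2_field_families_smooth: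
  assumes "U \<in> L2_field_families M" "\<epsilon> \<in> {0<..1}"
  shows "L2_smooth_field M (U \<epsilon>)"
proof -
  have "AE \<omega> in M. \<forall>\<epsilon>\<in>{0<..1}. smooth (\<lambda>x. U \<epsilon> x \<omega>)"
    using assms(1) by (simp add: L2_field_families_def)
  then have "AE \<omega> in M. smooth (\<lambda>x. U \<epsilon> x \<omega>)"
    by eventually_elim (use assms(2) in blast)
  then show ?thesis
    using assms unfolding L2_smooth_field_def field_L2_norm_eq[symmetric]
    by (simp add: L2_field_families_def field_deriv_def[abs_def])
qed

lemma L2_norm_le_SUP:
  assumes "L2_smooth_field M A" "compact K" "x \<in> K"
  shows "L2_norm M (field_deriv \<alpha> A x) \<le> (SUP x\<in>K. field_L2_norm M \<alpha> A x)"
  unfolding field_L2_norm_eq using assms by (intro cSUP_upper) (auto simp: L2_smooth_field_def)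

text \<open>Linearity of \<open>mpartial\<close> is available only for smooth paths, hence almost
  surely, and the norm does not see the exceptional set.\<close>

lemma L2_norm_field_diff:
  assumes A: "L2_smooth_field M A" and B: "L2_smooth_field M B"
    and AB: "L2_smooth_field M (\<lambda>x \<omega>. A x \<omega> - B x \<omega>)"
  shows "L2_norm M (\<lambda>\<omega>. field_deriv \<alpha> A x \<omega> - field_deriv \<alpha> B x \<omega>) =
    L2_norm M (field_deriv \<alpha> (\<lambda>x \<omega>. A x \<omega> - B x \<omega>) x)"
proof (rule L2_norm_cong_AE)
  have "AE \<omega> in M. smooth (\<lambda>x. A x \<omega>)" "AE \<omega> in M. smooth (\<lambda>x. B x \<omega>)"
    using A B by (simp_all add: L2_smooth_field_def)
  then show "AE \<omega> in M. field_deriv \<alpha> A x \<omega> - field_deriv \<alpha> B x \<omega> = field_deriv \<alpha> (\<lambda>x \<omega>. A x \<omega> - B x \<omega>) x \<omega>"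
    by eventually_elim (simp add: field_deriv_def mpartial_diff)
qed (intro L2_fun_diff L2_smooth_field_L2_fun assms)+

text \<open>Provides reflexivity of the relation on random fields, so that a representative belongs
  to its own class.\<close>

lemma Null_L2_zero: "(\<lambda>\<epsilon> x \<omega>. 0) \<in> (Null_L2 M :: (real \<Rightarrow> 'a::euclidean_space \<Rightarrow> 'w \<Rightarrow> real) set)"
proof -
  have C_diff: "C_diff k (\<lambda>x::'a. 0)" for k
  proof (induction k)
    case (Suc k)
    have "partial b (\<lambda>x::'a. 0) = (\<lambda>x. 0)" for b
      by (simp add: partial_def fun_eq_iff)
    then show ?case
      using Suc by simp
  qed simp
  then have smooth: "smooth (\<lambda>x::'a. 0)"
    by (simp add: smooth_def)
  \<comment> \<open>The zero function is its own difference with itself, so linearity forces every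
    derivative to vanish.\<close>
  have zero: "mpartial \<alpha> (\<lambda>y::'a. 0) x = 0" for \<alpha> x
    using mpartial_diff[OF smooth smooth, of \<alpha> x] by simp
  show ?thesis
    by (auto simp: Null_L2_def L2_field_families_def smooth zero L2_fun_zero field_L2_norm_def
        L2_norm_zero negligible_family_zero)
qed

section \<open>Moderateness and independence of the representative\<close>

context prob_space
begin

lemma autocov_smooth:
  assumes "U \<in> EM_L2 M" "\<epsilon> \<in> {0<..1}"
  shows "smooth (autocov M U \<epsilon>)"
  using assms L2_field_families_smooth[of U M \<epsilon>]
  by (simp add: autocov_eq field_covar_smooth EM_L2_def)

lemma autocov_EM:
  fixes U :: "real \<Rightarrow> 'c::euclidean_space \<Rightarrow> 'a \<Rightarrow> real"
  assumes U: "U \<in> EM_L2 M"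
  shows "autocov M U \<in> EM"
  unfolding EM_def
proof (intro CollectI conjI ballI allI impI)
  show "smooth (autocov M U \<epsilon>)" if "\<epsilon> \<in> {0<..1}" for \<epsilon>
    using autocov_smooth[OF U that] .
  fix K :: "('c \<times> 'c) set" and \<gamma> :: "'c \<times> 'c \<Rightarrow> nat"
  assume K: "compact K" "K \<noteq> {}"
  let ?S = "\<lambda>\<alpha> K \<epsilon>. SUP x\<in>K. field_L2_norm M \<alpha> (U \<epsilon>) x"
  \<comment> \<open>\<open>K\<close> lies in the product of its two projections, which are compact
    and separate the two variables in the bound.\<close>
  have cpt: "compact (fst ` K)" "compact (snd ` K)"
    using K by (auto intro!: compact_continuous_image continuous_intros)
  \<comment> \<open>The indices are fixed before \<epsilon>, so a single pair of moderate families
    controls the whole family.\<close>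
  obtain \<alpha> \<beta> where \<gamma>: "\<And>A. L2_smooth_field M A \<Longrightarrow>
      mpartial \<gamma> (field_covar M (\<lambda>_. 0) (\<lambda>_. 0) A) = field_covar M \<alpha> \<beta> A"
    using mpartial_field_covar[of \<gamma> "\<lambda>_. 0" "\<lambda>_. 0"] by metis
  have "moderate (\<lambda>\<epsilon>. 2 * ?S \<alpha> (fst ` K) \<epsilon> * ?S \<beta> (snd ` K) \<epsilon>)"
    using U K cpt by (intro moderate_mult[OF moderate_cmult]) (auto simp: EM_L2_def)
  then show "moderate (\<lambda>\<epsilon>. SUP z\<in>K. \<bar>mpartial \<gamma> (autocov M U \<epsilon>) z\<bar>)"
  proof (rule moderate_le)
    fix \<epsilon> :: real
    assume \<epsilon>: "\<epsilon> \<in> {0<..1}"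
    then have A: "L2_smooth_field M (U \<epsilon>)"
      using U by (intro L2_field_families_smooth) (auto simp: EM_L2_def)
    have "\<bar>field_covar M \<alpha> \<beta> (U \<epsilon>) z\<bar> \<le> 2 * ?S \<alpha> (fst ` K) \<epsilon> * ?S \<beta> (snd ` K) \<epsilon>" if z: "z \<in> K" for z
    proof -
      have "\<bar>field_covar M \<alpha> \<beta> (U \<epsilon>) z\<bar> \<le>
          2 * L2_norm M (field_deriv \<alpha> (U \<epsilon>) (fst z)) * L2_norm M (field_deriv \<beta> (U \<epsilon>) (snd z))"
        unfolding field_covar_def by (intro covar_le L2_smooth_field_L2_fun A)
      also have "\<dots> \<le> 2 * ?S \<alpha> (fst ` K) \<epsilon> * ?S \<beta> (snd ` K) \<epsilon>"
        using L2_norm_le_SUP[OF A cpt(1), of "fst z"] L2_norm_le_SUP[OF A cpt(2), of "snd z"] z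
        by (intro mult_mono) (auto simp: L2_norm_nonneg intro: order_trans[OF L2_norm_nonneg])
      finally show ?thesis .
    qed
    then show "\<bar>SUP z\<in>K. \<bar>mpartial \<gamma> (autocov M U \<epsilon>) z\<bar>\<bar> \<le> \<bar>2 * ?S \<alpha> (fst ` K) \<epsilon> * ?S \<beta> (snd ` K) \<epsilon>\<bar>"
      unfolding autocov_eq \<gamma>[OF A] by (intro abs_SUP_le K)
  qed
qed

text \<open>Bilinearity leaves two products, each with one factor from the negligible difference and
  one from a moderate representative.\<close>

lemma autocov_cong:
  fixes U V :: "real \<Rightarrow> 'c::euclidean_space \<Rightarrow> 'a \<Rightarrow> real"
  assumes UV: "(U, V) \<in> colombeau_L2_rel M"
  shows "(autocov M U, autocov M V) \<in> colombeau_rel"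
  unfolding colombeau_rel_iff
proof (intro conjI allI impI)
  let ?D = "\<lambda>\<epsilon> x \<omega>. U \<epsilon> x \<omega> - V \<epsilon> x \<omega>"
  have U: "U \<in> EM_L2 M" and V: "V \<in> EM_L2 M" and D: "?D \<in> Null_L2 M"
    using UV by (auto simp: colombeau_L2_rel_def)
  then show "autocov M U \<in> EM" "autocov M V \<in> EM"
    by (auto intro: autocov_EM)
  fix K :: "('c \<times> 'c) set" and \<gamma> :: "'c \<times> 'c \<Rightarrow> nat"
  assume K: "compact K" "K \<noteq> {}"
  let ?S = "\<lambda>U \<alpha> K \<epsilon>. SUP x\<in>K. field_L2_norm M \<alpha> (U \<epsilon>) x"
  have cpt: "compact (fst ` K)" "compact (snd ` K)"
    using K by (auto intro!: compact_continuous_image continuous_intros)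
  obtain \<alpha> \<beta> where \<gamma>: "\<And>A. L2_smooth_field M A \<Longrightarrow>
      mpartial \<gamma> (field_covar M (\<lambda>_. 0) (\<lambda>_. 0) A) = field_covar M \<alpha> \<beta> A"
    using mpartial_field_covar[of \<gamma> "\<lambda>_. 0" "\<lambda>_. 0"] by metis
  \<comment> \<open>In both products the negligible factor comes first, matching
    \<open>negligible_family_mult\<close>.\<close>
  let ?B = "\<lambda>\<epsilon>. 2 * ?S ?D \<alpha> (fst ` K) \<epsilon> * ?S U \<beta> (snd ` K) \<epsilon> + 2 * ?S ?D \<beta> (snd ` K) \<epsilon> * ?S V \<alpha> (fst ` K) \<epsilon>"
  have "negligible_family ?B"
    using U V D K cpt
    by (intro negligible_family_add negligible_family_mult[OF negligible_family_cmult]) (auto simp: EM_L2_def Null_L2_def)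
  then show "negligible_family (\<lambda>\<epsilon>. SUP z\<in>K. \<bar>mpartial \<gamma> (autocov M U \<epsilon>) z - mpartial \<gamma> (autocov M V \<epsilon>) z\<bar>)"
  proof (rule negligible_family_le)
    fix \<epsilon> :: real
    assume \<epsilon>: "\<epsilon> \<in> {0<..1}"
    have A: "L2_smooth_field M (U \<epsilon>)" and B: "L2_smooth_field M (V \<epsilon>)" and AB: "L2_smooth_field M (?D \<epsilon>)"
      using U V D L2_field_families_smooth[of U M] L2_field_families_smooth[of V M]
        L2_field_families_smooth[of ?D M] \<epsilon>
      by (auto simp: EM_L2_def Null_L2_def)
    have "\<bar>field_covar M \<alpha> \<beta> (U \<epsilon>) z - field_covar M \<alpha> \<beta> (V \<epsilon>) z\<bar> \<le> ?B \<epsilon>" if z: "z \<in> K" for z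
    proof -
      have "\<bar>field_covar M \<alpha> \<beta> (U \<epsilon>) z - field_covar M \<alpha> \<beta> (V \<epsilon>) z\<bar> \<le>
          2 * L2_norm M (field_deriv \<alpha> (?D \<epsilon>) (fst z)) * L2_norm M (field_deriv \<beta> (U \<epsilon>) (snd z)) +
          2 * L2_norm M (field_deriv \<alpha> (V \<epsilon>) (fst z)) * L2_norm M (field_deriv \<beta> (?D \<epsilon>) (snd z))"
        unfolding field_covar_def L2_norm_field_diff[OF A B AB, symmetric]
        by (intro covar_diff_le L2_smooth_field_L2_fun A B)
      also have "\<dots> = 2 * L2_norm M (field_deriv \<alpha> (?D \<epsilon>) (fst z)) * L2_norm M (field_deriv \<beta> (U \<epsilon>) (snd z)) +
          2 * L2_norm M (field_deriv \<beta> (?D \<epsilon>) (snd z)) * L2_norm M (field_deriv \<alpha> (V \<epsilon>) (fst z))"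
        by simp
      also have "\<dots> \<le> ?B \<epsilon>"
        using L2_norm_le_SUP[OF A cpt(2), of "snd z" \<beta>] L2_norm_le_SUP[OF B cpt(1), of "fst z" \<alpha>]
          L2_norm_le_SUP[OF AB cpt(1), of "fst z" \<alpha>] L2_norm_le_SUP[OF AB cpt(2), of "snd z" \<beta>] z
        by (intro add_mono mult_mono) (auto simp: L2_norm_nonneg intro: order_trans[OF L2_norm_nonneg])
      finally show ?thesis .
    qed
    then show "\<bar>SUP z\<in>K. \<bar>mpartial \<gamma> (autocov M U \<epsilon>) z - mpartial \<gamma> (autocov M V \<epsilon>) z\<bar>\<bar> \<le> \<bar>?B \<epsilon>\<bar>"
      unfolding autocov_eq \<gamma>[OF A] \<gamma>[OF B] by (intro abs_SUP_le K)
  qed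
qed

end

theorem corollary4p1:
  fixes M :: "'w measure"
    and u :: "(real \<Rightarrow> real ^ 'd \<Rightarrow> 'w \<Rightarrow> real) set"
  assumes "prob_space M" and "complete_measure M"
    and "u \<in> colombeau_L2 M"
  shows "(\<forall>U\<in>u. \<forall>\<epsilon>\<in>{0<..1}. \<forall>x y. integrable M (U \<epsilon> x) \<and> integrable M (\<lambda>\<omega>. U \<epsilon> x \<omega> * U \<epsilon> y \<omega>)) \<and>
    (\<forall>U\<in>u. (\<forall>\<epsilon>\<in>{0<..1}. smooth (autocov M U \<epsilon>)) \<and> autocov M U \<in> EM) \<and>
    (\<forall>U\<in>u. \<forall>V\<in>u. colombeau_rel `` {autocov M U} = colombeau_rel `` {autocov M V}) \<and>
    (\<exists>!C. C \<in> colombeau \<and> (\<forall>U\<in>u. autocov M U \<in> C))"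
proof -
  interpret prob_space M by fact
  obtain U0 where U0: "U0 \<in> EM_L2 M" and u: "u = colombeau_L2_rel M `` {U0}"
    using assms(3) by (auto simp: colombeau_L2_def elim: quotientE)
  have rel: "(U0, U) \<in> colombeau_L2_rel M" and EM: "U \<in> EM_L2 M" if "U \<in> u" for U
    using that u by (auto simp: colombeau_L2_rel_def)
  \<comment> \<open>This makes \<open>u\<close> nonempty, without which the uniqueness of the class
    would fail to follow.\<close>
  have "U0 \<in> u"
    using U0 by (simp add: u colombeau_L2_rel_def Null_L2_zero)
  let ?C = "colombeau_rel `` {autocov M U0}"
  have C: "colombeau_rel `` {autocov M U} = ?C" if "U \<in> u" for U
    using equiv_class_eq[OF equiv_colombeau_rel autocov_cong[OF rel[OF that]]] by simp
  \<comment> \<open>The Bochner integral is 0 by convention for non-integrable functions, so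
    integrability must be shown separately for \<open>autocov\<close> to consist of genuine
    expectations.\<close>
  have "integrable M (U \<epsilon> x) \<and> integrable M (\<lambda>\<omega>. U \<epsilon> x \<omega> * U \<epsilon> y \<omega>)"
    if "U \<in> u" "\<epsilon> \<in> {0<..1}" for U \<epsilon> x y
  proof -
    have "U \<in> L2_field_families M"
      using EM[OF that(1)] by (simp add: EM_L2_def)
    then have "field_deriv (\<lambda>_. 0) (U \<epsilon>) x \<in> L2_fun M" for x
      using that(2) by (intro L2_smooth_field_L2_fun L2_field_families_smooth)
    then have "U \<epsilon> x \<in> L2_fun M" for x
      by (simp add: field_deriv_def[abs_def] mpartial_zero)
    then show ?thesis
      by (intro conjI L2_fun_integrable L2_fun_mult_integrable)
  qed
  moreover have "(\<forall>\<epsilon>\<in>{0<..1}. smooth (autocov M U \<epsilon>)) \<and> autocov M U \<in> EM" if "U \<in> u" for U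
    using EM[OF that] by (auto intro: autocov_smooth autocov_EM)
  moreover have "\<exists>!C. C \<in> colombeau \<and> (\<forall>U\<in>u. autocov M U \<in> C)"
  proof (rule ex1I[of _ ?C])
    show "?C \<in> colombeau \<and> (\<forall>U\<in>u. autocov M U \<in> ?C)"
      using U0 rel by (auto simp: colombeau_def intro: quotientI autocov_EM autocov_cong)
    \<comment> \<open>Any class containing \<open>autocov M U0\<close> is the class of that element,
      because the relation is an equivalence.\<close>
    fix C
    assume "C \<in> colombeau \<and> (\<forall>U\<in>u. autocov M U \<in> C)"
    then have "C \<in> EM // colombeau_rel" "autocov M U0 \<in> C"
      using \<open>U0 \<in> u\<close> by (auto simp: colombeau_def)
    then obtain W where "C = colombeau_rel `` {W}" "(W, autocov M U0) \<in> colombeau_rel"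
      by (auto elim: quotientE)
    then show "C = ?C"
      using equiv_class_eq[OF equiv_colombeau_rel] by simp
  qed
  ultimately show ?thesis
    using C by simp
qed

end
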